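(* There is an absolute constant $C>0$ such that the following holds for all positive integers $N,S,T$. Let $\mathcal{A}=(\mathcal{A}_1,\mathcal{A}_2)$ be an auxiliary-input algorithm for the permutation inversion problem on $[N]$ consisting of two stages: (1) $\mathcal{A}_1$ is given unbounded access to a permutation $\pi:[N]\to[N]$ and outputs an $S$-qubit (quantum) advice state $\mathcal{A}_1(\pi)$; (2) given the state $\mathcal{A}_1(\pi)$ and a challenge point $y\in[N]$, $\mathcal{A}_2^{\pi}$ makes at most $T$ quantum queries to $\pi$ and outputs a point $x\in[N]$. Then \[ \Pr_{\pi,y}\Big[\pi\big(\mathcal{A}_2^{\pi}(\mathcal{A}_1(\pi),y)\big)=y\Big]\le C\left(\frac{ST}{N}+\frac{T^2}{N}\right), \] where $\pi$ is sampled uniformly from the symmetric group $S_N$ and $y$ uniformly from $[N]$, independently.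
   Context: A quantum query to a permutation $\pi$ of $[N]$ is an application of the unitary $\ket{x}\ket{z}\mapsto\ket{x}\ket{z\oplus\pi(x)}$ on registers holding elements of $[N]$ (here $\oplus$ denotes a fixed group operation on $[N]$, e.g. addition modulo $N$), possibly controlled and interleaved with arbitrary unitaries on the algorithm's workspace. The algorithm $\mathcal{A}_2$ may use arbitrary ancilla workspace in addition to the $S$-qubit advice. The statement is the paper's $O(ST/N+T^2/N)$ bound written with an explicit absolute constant. *)

theory Defs
  imports
    "HOL-Probability.Probability_Mass_Function"
    "Jordan_Normal_Form.Schur_Decomposition"
begin

text \<open>The set \<open>[N]\<close> is rendered as \<open>{..<N}\<close>.\<close>

section \<open>Finite-dimensional quantum mechanics\<close>

definition kron :: "complex Matrix.mat \<Rightarrow> complex Matrix.mat \<Rightarrow> complex Matrix.mat" where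
  "kron A B = Matrix.mat (dim_row A * dim_row B) (dim_col A * dim_col B)
     (\<lambda>(i, j). A $$ (i div dim_row B, j div dim_col B) * B $$ (i mod dim_row B, j mod dim_col B))"

definition mat_trace :: "complex Matrix.mat \<Rightarrow> complex" where
  "mat_trace A = (\<Sum>i<dim_row A. A $$ (i, i))"

definition unitary_mat :: "nat \<Rightarrow> complex Matrix.mat \<Rightarrow> bool" where
  "unitary_mat d U \<longleftrightarrow> U \<in> carrier_mat d d \<and> mat_adjoint U * U = 1\<^sub>m d \<and> U * mat_adjoint U = 1\<^sub>m d"

text \<open>The order on \<^typ>\<open>complex\<close> makes \<open>0 \<le> z\<close> mean that \<open>z\<close> is real and nonnegative.\<close>

definition density_operator :: "nat \<Rightarrow> complex Matrix.mat \<Rightarrow> bool" where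
  "density_operator d \<rho> \<longleftrightarrow>
     \<rho> \<in> carrier_mat d d \<and> mat_adjoint \<rho> = \<rho> \<and>
     (\<forall>v\<in>carrier_vec d. 0 \<le> (\<rho> *\<^sub>v v) \<bullet>c v) \<and> mat_trace \<rho> = 1"

text \<open>\<open>basis_proj d i\<close> is the projector \<open>|i\<rangle>\<langle>i|\<close> on a \<open>d\<close>-dimensional space.\<close>

definition basis_proj :: "nat \<Rightarrow> nat \<Rightarrow> complex Matrix.mat" where
  "basis_proj d i = Matrix.mat d d (\<lambda>(r, c). if r = i \<and> c = i then 1 else 0)"


section \<open>Quantum queries\<close>

text \<open>
  The query unitary \<open>|x\<rangle>|z\<rangle> \<mapsto> |x\<rangle>|z \<oplus> \<pi>(x)\<rangle>\<close>, where \<open>\<oplus>\<close> is the operation of a group \<open>G\<close> with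
  carrier \<open>{..<N}\<close>; as in \<^const>\<open>kron\<close>, the basis state \<open>|x\<rangle>|z\<rangle>\<close> has index \<open>x * N + z\<close>.
\<close>

definition query_unitary :: "nat \<Rightarrow> nat monoid \<Rightarrow> (nat \<Rightarrow> nat) \<Rightarrow> complex Matrix.mat" where
  "query_unitary N G \<pi> = Matrix.mat (N * N) (N * N)
     (\<lambda>(i, j). if i div N = j div N \<and> i mod N = (j mod N) \<otimes>\<^bsub>G\<^esub> \<pi> (j div N) then 1 else 0)"

text \<open>
  Prepending a control qubit. Every query is made in this controlled form; an algorithm makes an
  uncontrolled query by keeping the control qubit in state \<open>|1\<rangle>\<close>.
\<close>

definition controlled_query :: "nat \<Rightarrow> nat monoid \<Rightarrow> (nat \<Rightarrow> nat) \<Rightarrow> complex Matrix.mat" where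
  "controlled_query N G \<pi> =
     kron (basis_proj 2 0) (1\<^sub>m (N * N)) + kron (basis_proj 2 1) (query_unitary N G \<pi>)"


section \<open>Auxiliary-input inversion algorithms\<close>

text \<open>
  \<open>advice \<pi>\<close> is the state \<open>\<A>\<^sub>1(\<pi>)\<close>. The remaining fields describe \<open>\<A>\<^sub>2\<close>: the dimension of its ancilla
  and, for each challenge \<open>y\<close>, the number of queries and the unitaries \<open>gate y 0, \<dots>, gate y (queries y)\<close>
  applied before, between and after the queries. None of them depends on \<open>\<pi>\<close>.
\<close>

record aux_algorithm =
  advice :: "(nat \<Rightarrow> nat) \<Rightarrow> complex Matrix.mat"
  ancilla_dim :: nat
  queries :: "nat \<Rightarrow> nat"
  gate :: "nat \<Rightarrow> nat \<Rightarrow> complex Matrix.mat"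

text \<open>
  The registers of \<open>\<A>\<^sub>2\<close> are, in this order: the control qubit (dimension \<open>2\<close>), the query input and the
  query output (dimension \<open>N\<close> each), the advice (\<open>S\<close> qubits, dimension \<open>2 ^ S\<close>), and the ancilla.
\<close>

definition total_dim :: "nat \<Rightarrow> nat \<Rightarrow> aux_algorithm \<Rightarrow> nat" where
  "total_dim N S A = 2 * (N * N) * (2 ^ S * ancilla_dim A)"

definition is_aux_algorithm :: "nat \<Rightarrow> nat \<Rightarrow> nat \<Rightarrow> aux_algorithm \<Rightarrow> bool" where
  "is_aux_algorithm N S T A \<longleftrightarrow>
     (\<forall>\<pi>. \<pi> permutes {..<N} \<longrightarrow> density_operator (2 ^ S) (advice A \<pi>)) \<and>
     0 < ancilla_dim A \<and>
     (\<forall>y<N. queries A y \<le> T \<and> (\<forall>k\<le>queries A y. unitary_mat (total_dim N S A) (gate A y k)))"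

text \<open>All registers other than the advice start in state \<open>|0\<rangle>\<close>.\<close>

definition initial_state :: "nat \<Rightarrow> aux_algorithm \<Rightarrow> (nat \<Rightarrow> nat) \<Rightarrow> complex Matrix.mat" where
  "initial_state N A \<pi> =
     kron (basis_proj (2 * (N * N)) 0) (kron (advice A \<pi>) (basis_proj (ancilla_dim A) 0))"

primrec circuit :: "complex Matrix.mat \<Rightarrow> (nat \<Rightarrow> complex Matrix.mat) \<Rightarrow> nat \<Rightarrow> complex Matrix.mat" where
  "circuit Q U 0 = U 0"
| "circuit Q U (Suc k) = U (Suc k) * (Q * circuit Q U k)"

definition final_state ::
  "nat \<Rightarrow> nat \<Rightarrow> nat monoid \<Rightarrow> aux_algorithm \<Rightarrow> (nat \<Rightarrow> nat) \<Rightarrow> nat \<Rightarrow> complex Matrix.mat" where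
  "final_state N S G A \<pi> y =
     (let V = circuit (kron (controlled_query N G \<pi>) (1\<^sub>m (2 ^ S * ancilla_dim A)))
                (gate A y) (queries A y)
      in V * initial_state N A \<pi> * mat_adjoint V)"

text \<open>
  The output is obtained by measuring the query input register in the computational basis. As the
  last gate and the ancilla are arbitrary, this covers every measurement with outcomes in \<open>[N]\<close>.
\<close>

definition output_prob ::
  "nat \<Rightarrow> nat \<Rightarrow> nat monoid \<Rightarrow> aux_algorithm \<Rightarrow> (nat \<Rightarrow> nat) \<Rightarrow> nat \<Rightarrow> nat \<Rightarrow> real" where
  "output_prob N S G A \<pi> y x =
     Re (mat_trace (kron (1\<^sub>m 2) (kron (basis_proj N x) (1\<^sub>m (N * (2 ^ S * ancilla_dim A))))
                    * final_state N S G A \<pi> y))"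

text \<open>
  The probability that \<open>\<pi>(x) = y\<close> for the output \<open>x\<close>, over independent uniform \<open>\<pi>\<close> and \<open>y\<close> and the
  randomness of the measurement.
\<close>

definition success_prob :: "nat \<Rightarrow> nat \<Rightarrow> nat monoid \<Rightarrow> aux_algorithm \<Rightarrow> real" where
  "success_prob N S G A =
     measure_pmf.expectation (pair_pmf (pmf_of_set {\<pi>. \<pi> permutes {..<N}}) (pmf_of_set {..<N}))
       (\<lambda>(\<pi>, y). \<Sum>x | x < N \<and> \<pi> x = y. output_prob N S G A \<pi> y x)"

end

theory Submission
  imports Defs
begin

text \<open>
  Let \<open>D = 2 ^ S\<close>, and let \<open>E \<pi>\<close> be the \<open>D \<times> D\<close> matrix whose trace product with an advice state is \<open>N\<close> times
  its success probability for a random challenge. It is positive, and its entries have degree at most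
  \<open>2T + 2\<close> as functions of \<open>\<pi>\<close>, where a function has degree at most \<open>J\<close> if it is a sum of functions that
  depend on \<open>J\<close> values of \<open>\<pi>\<close>. Bounding the trace product by a moment \<open>E ^ k\<close> with \<open>k \<approx> S\<close> replaces the advice by
  a maximally mixed state at the cost of a constant factor, and it remains to show that \<open>E\<close> has norm
  \<open>O(J + T\<^sup>2)\<close> on vectors of degree \<open>J = O(ST)\<close>.

  For this, compare the run on \<open>\<pi>\<close> with the run on \<open>\<pi>(x := y)\<close> for a uniform \<open>x\<close> independent of \<open>\<pi>\<close>. A hybrid
  argument bounds their distance by \<open>O(T / \<surd>N)\<close>. In the modified function the two preimages of \<open>y\<close> play the same
  role, except that exchanging them changes the initial state by a random transposition of its argument \<open>\<pi>\<close>;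
  the random transposition walk moves a function of degree \<open>J\<close> by at most \<open>O(\<surd>(J / N))\<close> in mean square.
  Finding the independent point \<open>x\<close> is as unlikely as guessing it.
\<close>

section \<open>Functions of low degree on the symmetric group\<close>

text \<open>The functions compared are arbitrary, not only permutations: juntas arise from entries
  of query matrices, which are defined for every oracle.\<close>

definition determined_by :: "nat set \<Rightarrow> ((nat \<Rightarrow> nat) \<Rightarrow> complex) \<Rightarrow> bool" where
  "determined_by a g \<longleftrightarrow> (\<forall>\<pi> \<sigma>. (\<forall>i\<in>a. \<pi> i = \<sigma> i) \<longrightarrow> g \<pi> = g \<sigma>)"

text \<open>On \<open>perms N\<close> these are the polynomials of degree at most \<open>J\<close>
  in the indicators of \<open>\<pi> i = j\<close>. Closing juntas under addition avoids carrying a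
  decomposition and turns proofs about degree into inductions.\<close>

inductive low_degree :: "nat \<Rightarrow> ((nat \<Rightarrow> nat) \<Rightarrow> complex) \<Rightarrow> bool" for J where
  junta: "finite a \<Longrightarrow> card a \<le> J \<Longrightarrow> determined_by a g \<Longrightarrow> low_degree J g"
| add: "low_degree J g \<Longrightarrow> low_degree J h \<Longrightarrow> low_degree J (\<lambda>\<pi>. g \<pi> + h \<pi>)"

lemma low_degree_const: "low_degree J (\<lambda>\<pi>. c)"
  by (rule low_degree.junta[of "{}"]) (auto simp: determined_by_def)

lemma low_degree_sum:
  assumes "\<And>x. x \<in> A \<Longrightarrow> low_degree J (\<lambda>\<pi>. f x \<pi>)"
  shows "low_degree J (\<lambda>\<pi>. \<Sum>x\<in>A. f x \<pi>)"
  using assms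
proof (induction A rule: infinite_finite_induct)
  case (insert x A)
  then show ?case
    using low_degree.add[of J "f x" "\<lambda>\<pi>. \<Sum>x\<in>A. f x \<pi>"] by simp
qed (simp_all add: low_degree_const)

lemma low_degree_mono: "low_degree J g \<Longrightarrow> J \<le> K \<Longrightarrow> low_degree K g"
  by (induction rule: low_degree.induct) (auto intro: low_degree.intros)

lemma low_degree_cnj: "low_degree J g \<Longrightarrow> low_degree J (\<lambda>\<pi>. cnj (g \<pi>))"
proof (induction rule: low_degree.induct)
  case (junta a g)
  show ?case
    by (rule low_degree.junta[OF junta(1,2)]) (use junta(3) in \<open>auto simp: determined_by_def\<close>)
qed (simp add: low_degree.add)

text \<open>A product of juntas on \<open>a\<close> and \<open>b\<close> is a junta on
  \<open>a \<union> b\<close>; distributivity extends this to sums, one factor at a time.\<close>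

lemma low_degree_mult:
  assumes "low_degree J g" "low_degree K h"
  shows "low_degree (J + K) (\<lambda>\<pi>. g \<pi> * h \<pi>)"
  using assms
proof (induction rule: low_degree.induct)
  case (junta a g)
  from junta(4) show ?case
  proof (induction rule: low_degree.induct)
    case (junta b h)
    note b = this
    have "card (a \<union> b) \<le> J + K"
      using card_Un_le[of a b] b(2) \<open>card a \<le> J\<close> by linarith
    moreover have "determined_by (a \<union> b) (\<lambda>\<pi>. g \<pi> * h \<pi>)"
      unfolding determined_by_def
    proof (intro allI impI)
      fix \<pi> \<sigma> :: "nat \<Rightarrow> nat"
      assume *: "\<forall>i\<in>a \<union> b. \<pi> i = \<sigma> i"
      have "g \<pi> = g \<sigma>" "h \<pi> = h \<sigma>"
        using * \<open>determined_by a g\<close> \<open>determined_by b h\<close> unfolding determined_by_def by blast+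
      then show "g \<pi> * h \<pi> = g \<sigma> * h \<sigma>" by simp
    qed
    ultimately show ?case
      using \<open>finite a\<close> b(1) by (intro low_degree.junta[of "a \<union> b"]) auto
  next
    case (add h h')
    then show ?case
      using low_degree.add[of "J + K" "\<lambda>\<pi>. g \<pi> * h \<pi>" "\<lambda>\<pi>. g \<pi> * h' \<pi>"]
      by (simp add: distrib_left)
  qed
next
  case (add g g')
  then show ?case
    using low_degree.add[of "J + K" "\<lambda>\<pi>. g \<pi> * h \<pi>" "\<lambda>\<pi>. g' \<pi> * h \<pi>"]
    by (simp add: distrib_right)
qed

lemma low_degree_value: "low_degree 1 (\<lambda>\<pi>. F (\<pi> x))"
  by (rule low_degree.junta[of "{x}"]) (auto simp: determined_by_def)

section \<open>Euclidean norm of complex families\<close>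

definition l2 :: "'a set \<Rightarrow> ('a \<Rightarrow> complex) \<Rightarrow> real" where
  "l2 A f = L2_set (\<lambda>i. cmod (f i)) A"

lemma l2_nonneg [simp]: "0 \<le> l2 A f"
  by (simp add: l2_def)

lemma l2_power2: "(l2 A f)\<^sup>2 = (\<Sum>i\<in>A. (cmod (f i))\<^sup>2)"
  by (simp add: l2_def L2_set_def sum_nonneg)

lemma l2_cong: "A = B \<Longrightarrow> (\<And>i. i \<in> B \<Longrightarrow> f i = g i) \<Longrightarrow> l2 A f = l2 B g"
  unfolding l2_def by (intro L2_set_cong) auto

lemma l2_triangle: "l2 A (\<lambda>i. f i + g i) \<le> l2 A f + l2 A g"
proof -
  have "l2 A (\<lambda>i. f i + g i) \<le> L2_set (\<lambda>i. cmod (f i) + cmod (g i)) A"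
    unfolding l2_def by (intro L2_set_mono norm_triangle_ineq) simp
  also have "\<dots> \<le> l2 A f + l2 A g"
    unfolding l2_def by (rule L2_set_triangle_ineq)
  finally show ?thesis .
qed

lemma l2_triangle_sum: "l2 A (\<lambda>i. \<Sum>k\<in>K. f k i) \<le> (\<Sum>k\<in>K. l2 A (f k))"
proof (induction K rule: infinite_finite_induct)
  case (insert k K)
  then show ?case
    using l2_triangle[of A "f k" "\<lambda>i. \<Sum>k\<in>K. f k i"] by simp
qed (simp_all add: l2_def L2_set_def)

lemma l2_uminus: "l2 A (\<lambda>i. - f i) = l2 A f"
  by (simp add: l2_def)

lemma l2_diff_le: "l2 A (\<lambda>i. f i - g i) \<le> l2 A f + l2 A g"
  using l2_triangle[of A f "\<lambda>i. - g i"] by (simp add: l2_uminus)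

lemma l2_diff_commute: "l2 A (\<lambda>i. f i - g i) = l2 A (\<lambda>i. g i - f i)"
  by (simp add: l2_def norm_minus_commute)

lemma l2_le_add_diff: "l2 A f \<le> l2 A g + l2 A (\<lambda>i. f i - g i)"
  using l2_triangle[of A g "\<lambda>i. f i - g i"] by simp

lemma l2_mono_set: "finite B \<Longrightarrow> A \<subseteq> B \<Longrightarrow> l2 A f \<le> l2 B f"
  unfolding l2_def L2_set_def by (intro real_sqrt_le_mono sum_mono2) auto

lemma l2_Cauchy_Schwarz: "cmod (\<Sum>i\<in>A. f i * g i) \<le> l2 A f * l2 A g"
proof -
  have "cmod (\<Sum>i\<in>A. f i * g i) \<le> (\<Sum>i\<in>A. \<bar>cmod (f i)\<bar> * \<bar>cmod (g i)\<bar>)"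
    by (rule order_trans[OF norm_sum]) (simp add: norm_mult)
  also have "\<dots> \<le> l2 A f * l2 A g"
    unfolding l2_def by (rule L2_set_mult_ineq)
  finally show ?thesis .
qed

lemma l2_cnj [simp]: "l2 A (\<lambda>i. cnj (f i)) = l2 A f"
  by (simp add: l2_def)

lemma l2_reindex: "bij_betw h A B \<Longrightarrow> l2 A (\<lambda>i. f (h i)) = l2 B f"
  unfolding l2_def L2_set_def by (simp add: sum.reindex_bij_betw[of h A B "\<lambda>i. (cmod (f i))\<^sup>2"])

section \<open>Laplacian of the random transposition walk\<close>

abbreviation perms :: "nat \<Rightarrow> (nat \<Rightarrow> nat) set" where
  "perms N \<equiv> {\<pi>. \<pi> permutes {..<N}}"

lemma finite_perms [simp]: "finite (perms N)"
  by (simp add: finite_permutations)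

abbreviation swap :: "nat \<Rightarrow> nat \<Rightarrow> nat \<Rightarrow> nat" where
  "swap \<equiv> Transposition.transpose"

lemma bij_betw_comp_swap:
  assumes "i < N" "j < N"
  shows "bij_betw (\<lambda>\<pi>. \<pi> \<circ> swap i j) (perms N) (perms N)"
proof (rule bij_betw_byWitness[where f' = "\<lambda>\<pi>. \<pi> \<circ> swap i j"])
  have "\<pi> \<circ> swap i j permutes {..<N}" if "\<pi> permutes {..<N}" for \<pi>
    using that assms by (intro permutes_compose permutes_swap_id) auto
  then show "(\<lambda>\<pi>. \<pi> \<circ> swap i j) ` perms N \<subseteq> perms N" "(\<lambda>\<pi>. \<pi> \<circ> swap i j) ` perms N \<subseteq> perms N"
    by auto
qed (auto simp: comp_assoc)

text \<open>Unnormalised Laplacian of the walk that multiplies \<open>\<pi>\<close> on the right by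
  a random transposition. Acting on the arguments of \<open>\<pi>\<close>, a transposition away from
  the points of a junta is invisible to it. Pairs are ordered, and those with \<open>i = j\<close>
  contribute zero.\<close>

definition lap :: "nat \<Rightarrow> ((nat \<Rightarrow> nat) \<Rightarrow> complex) \<Rightarrow> (nat \<Rightarrow> nat) \<Rightarrow> complex" where
  "lap N g \<pi> = (\<Sum>(i, j)\<in>{..<N} \<times> {..<N}. g \<pi> - g (\<pi> \<circ> swap i j))"

lemma lap_add: "lap N (\<lambda>\<pi>. g \<pi> + h \<pi>) = (\<lambda>\<pi>. lap N g \<pi> + lap N h \<pi>)"
  unfolding lap_def by (simp add: fun_eq_iff sum.distrib[symmetric] case_prod_unfold algebra_simps)

lemma lap_pow_add:
  "(lap N ^^ m) (\<lambda>\<pi>. g \<pi> + h \<pi>) = (\<lambda>\<pi>. (lap N ^^ m) g \<pi> + (lap N ^^ m) h \<pi>)"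
  by (induction m) (simp_all add: lap_add)

lemma sum_comp_swap:
  assumes "i < N" "j < N"
  shows "(\<Sum>\<pi>\<in>perms N. f (\<pi> \<circ> swap i j)) = (\<Sum>\<pi>\<in>perms N. f \<pi>)"
  using sum.reindex_bij_betw[OF bij_betw_comp_swap[OF assms]] .

text \<open>Right multiplication by a transposition is an involution that permutes
  \<open>perms N\<close>, so each summand of \<open>lap\<close> is self-adjoint.\<close>

lemma lap_self_adjoint:
  "(\<Sum>\<pi>\<in>perms N. cnj (lap N f \<pi>) * g \<pi>) = (\<Sum>\<pi>\<in>perms N. cnj (f \<pi>) * lap N g \<pi>)"
proof -
  have "(\<Sum>\<pi>\<in>perms N. cnj (f (\<pi> \<circ> swap i j)) * g \<pi>)
      = (\<Sum>\<pi>\<in>perms N. cnj (f \<pi>) * g (\<pi> \<circ> swap i j))" if "i < N" "j < N" for i j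
    using sum_comp_swap[OF that, of "\<lambda>\<pi>. cnj (f \<pi>) * g (\<pi> \<circ> swap i j)"]
    by (simp add: comp_assoc)
  then have *: "(\<Sum>\<pi>\<in>perms N. cnj (f \<pi> - f (\<pi> \<circ> swap i j)) * g \<pi>)
      = (\<Sum>\<pi>\<in>perms N. cnj (f \<pi>) * (g \<pi> - g (\<pi> \<circ> swap i j)))" if "i < N" "j < N" for i j
    using that by (simp add: algebra_simps sum_subtractf)
  have "(\<Sum>\<pi>\<in>perms N. cnj (lap N f \<pi>) * g \<pi>)
      = (\<Sum>(i, j)\<in>{..<N} \<times> {..<N}. \<Sum>\<pi>\<in>perms N. cnj (f \<pi> - f (\<pi> \<circ> swap i j)) * g \<pi>)"
    unfolding lap_def cnj_sum sum_distrib_right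
    by (subst sum.swap) (simp add: case_prod_unfold)
  also have "\<dots> = (\<Sum>(i, j)\<in>{..<N} \<times> {..<N}. \<Sum>\<pi>\<in>perms N. cnj (f \<pi>) * (g \<pi> - g (\<pi> \<circ> swap i j)))"
    by (rule sum.cong) (auto simp: * simp del: complex_cnj_diff)
  also have "\<dots> = (\<Sum>\<pi>\<in>perms N. cnj (f \<pi>) * lap N g \<pi>)"
    unfolding lap_def sum_distrib_left
    by (subst sum.swap) (simp add: case_prod_unfold)
  finally show ?thesis .
qed

lemma lap_pow_self_adjoint:
  "(\<Sum>\<pi>\<in>perms N. cnj ((lap N ^^ m) f \<pi>) * g \<pi>) = (\<Sum>\<pi>\<in>perms N. cnj (f \<pi>) * (lap N ^^ m) g \<pi>)"
proof (induction m arbitrary: g)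
  case (Suc m)
  have "(\<Sum>\<pi>\<in>perms N. cnj ((lap N ^^ Suc m) f \<pi>) * g \<pi>)
      = (\<Sum>\<pi>\<in>perms N. cnj ((lap N ^^ m) f \<pi>) * lap N g \<pi>)"
    by (simp add: lap_self_adjoint)
  also have "\<dots> = (\<Sum>\<pi>\<in>perms N. cnj (f \<pi>) * (lap N ^^ Suc m) g \<pi>)"
    by (simp add: Suc funpow_swap1)
  finally show ?case .
qed simp

text \<open>Self-adjointness moves all \<open>m\<close> applications to one side, which makes the
  left side the inner product of \<open>g\<close> with its iterate of order \<open>2 * m\<close>;
  then Cauchy-Schwarz applies.\<close>

lemma l2_lap_pow_log_convex:
  "(l2 (perms N) ((lap N ^^ m) g))\<^sup>2 \<le> l2 (perms N) g * l2 (perms N) ((lap N ^^ (2 * m)) g)"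
proof -
  let ?h = "(lap N ^^ m) g"
  have "complex_of_real ((l2 (perms N) ?h)\<^sup>2) = (\<Sum>\<pi>\<in>perms N. cnj (?h \<pi>) * ?h \<pi>)"
    by (simp add: l2_power2 complex_norm_square mult.commute del: of_real_power)
  also have "\<dots> = (\<Sum>\<pi>\<in>perms N. cnj (g \<pi>) * (lap N ^^ (2 * m)) g \<pi>)"
    by (simp add: lap_pow_self_adjoint mult_2 funpow_add)
  finally have "(l2 (perms N) ?h)\<^sup>2 = cmod (\<Sum>\<pi>\<in>perms N. cnj (g \<pi>) * (lap N ^^ (2 * m)) g \<pi>)"
    by (metis abs_power2 norm_of_real)
  also have "\<dots> \<le> l2 (perms N) (\<lambda>\<pi>. cnj (g \<pi>)) * l2 (perms N) ((lap N ^^ (2 * m)) g)"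
    by (rule l2_Cauchy_Schwarz)
  finally show ?thesis by simp
qed

text \<open>Being determined by \<open>a\<close> is restated as invariance under right translations fixing \<open>a\<close>, which \<open>lap\<close> visibly
  preserves because conjugation permutes the transpositions.\<close>

definition fixed_by :: "nat \<Rightarrow> nat set \<Rightarrow> ((nat \<Rightarrow> nat) \<Rightarrow> complex) \<Rightarrow> bool" where
  "fixed_by N a g \<longleftrightarrow> (\<forall>\<pi>\<in>perms N. \<forall>\<rho>\<in>perms N. (\<forall>i\<in>a. \<rho> i = i) \<longrightarrow> g (\<pi> \<circ> \<rho>) = g \<pi>)"

lemma determined_by_fixed_by: "determined_by a g \<Longrightarrow> fixed_by N a g"
  unfolding determined_by_def fixed_by_def by (metis comp_apply)

lemma fixed_by_lap:
  assumes "fixed_by N a g"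
  shows "fixed_by N a (lap N g)"
  unfolding fixed_by_def
proof (intro ballI impI)
  fix \<pi> \<rho> assume \<pi>: "\<pi> \<in> perms N" and \<rho>: "\<rho> \<in> perms N" and fixed: "\<forall>i\<in>a. \<rho> i = i"
  have inv: "g (\<sigma> \<circ> \<rho>) = g \<sigma>" if "\<sigma> \<in> perms N" for \<sigma>
    using assms that \<rho> fixed unfolding fixed_by_def by blast
  have \<rho>b: "bij \<rho>" "bij_betw \<rho> {..<N} {..<N}"
    using \<rho> by (auto intro: permutes_bij permutes_imp_bij)
  have step: "g (\<pi> \<circ> \<rho>) - g (\<pi> \<circ> \<rho> \<circ> swap i j) = g \<pi> - g (\<pi> \<circ> swap (\<rho> i) (\<rho> j))"
    if "i < N" "j < N" for i j
  proof -
    have lt: "\<rho> i < N" "\<rho> j < N"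
      using \<rho> that permutes_in_image[of \<rho> "{..<N}"] by auto
    have "\<rho> \<circ> swap i j = swap (\<rho> i) (\<rho> j) \<circ> \<rho>"
      using \<rho>b(1) by (auto simp: fun_eq_iff Transposition.transpose_def dest: bij_is_inj injD)
    moreover have "\<pi> \<circ> swap (\<rho> i) (\<rho> j) \<in> perms N"
      using bij_betw_comp_swap[OF lt] \<pi> by (auto simp: bij_betw_def)
    ultimately show ?thesis
      using inv[OF \<pi>] inv[of "\<pi> \<circ> swap (\<rho> i) (\<rho> j)"] by (simp add: comp_assoc)
  qed
  \<comment> \<open>Conjugation by \<open>\<rho>\<close> turns \<open>swap i j\<close> into
    \<open>swap (\<rho> i) (\<rho> j)\<close>, which only relabels the pairs of the sum.\<close>
  have "bij_betw (map_prod \<rho> \<rho>) ({..<N} \<times> {..<N}) ({..<N} \<times> {..<N})"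
    using \<rho>b(2) by (intro bij_betw_map_prod)
  from sum.reindex_bij_betw[OF this, of "\<lambda>(i, j). g \<pi> - g (\<pi> \<circ> swap i j)"]
  have "(\<Sum>(i, j)\<in>{..<N} \<times> {..<N}. g \<pi> - g (\<pi> \<circ> swap (\<rho> i) (\<rho> j))) = lap N g \<pi>"
    by (simp add: lap_def case_prod_unfold)
  moreover have "lap N g (\<pi> \<circ> \<rho>)
      = (\<Sum>(i, j)\<in>{..<N} \<times> {..<N}. g \<pi> - g (\<pi> \<circ> swap (\<rho> i) (\<rho> j)))"
    unfolding lap_def by (rule sum.cong[OF refl], clarify, rule step) auto
  ultimately show "lap N g (\<pi> \<circ> \<rho>) = lap N g \<pi>"
    by simp
qed

lemma fixed_by_lap_pow: "fixed_by N a g \<Longrightarrow> fixed_by N a ((lap N ^^ m) g)"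
  by (induction m) (simp_all add: fixed_by_lap)

lemma card_pairs_touching:
  assumes "finite a"
  shows "card {(i, j). i < N \<and> j < N \<and> (i \<in> a \<or> j \<in> a)} \<le> 2 * card a * N"
proof -
  have "{(i, j). i < N \<and> j < N \<and> (i \<in> a \<or> j \<in> a)} \<subseteq> a \<times> {..<N} \<union> {..<N} \<times> a"
    by auto
  then have "card {(i, j). i < N \<and> j < N \<and> (i \<in> a \<or> j \<in> a)} \<le> card (a \<times> {..<N} \<union> {..<N} \<times> a)"
    using assms by (intro card_mono) auto
  also have "\<dots> \<le> card (a \<times> {..<N}) + card ({..<N} \<times> a)"
    by (rule card_Un_le)
  finally show ?thesis by (simp add: card_cartesian_product mult.commute)
qed

text \<open>A transposition of two points outside \<open>a\<close> leaves \<open>g\<close>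
  unchanged, so at most \<open>2 * J * N\<close> ordered pairs contribute. Each contributes norm at
  most \<open>2 * l2 (perms N) g\<close>, as right translation is an isometry.\<close>

lemma l2_lap_fixed_by:
  assumes "fixed_by N a g" "finite a" "card a \<le> J"
  shows "l2 (perms N) (lap N g) \<le> (4 * real J * real N) * l2 (perms N) g"
proof -
  define B where "B = {(i, j). i < N \<and> j < N \<and> (i \<in> a \<or> j \<in> a)}"
  have Bsub: "B \<subseteq> {..<N} \<times> {..<N}" by (auto simp: B_def)
  have zero: "g \<pi> - g (\<pi> \<circ> swap i j) = 0" if "\<pi> \<in> perms N" "i < N" "j < N" "(i, j) \<notin> B" for \<pi> i j
  proof -
    have "\<forall>k\<in>a. swap i j k = k"
      using that by (auto simp: B_def Transposition.transpose_def)
    then show ?thesis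
      using assms(1) that permutes_swap_id[of i "{..<N}" j] unfolding fixed_by_def by auto
  qed
  have "l2 (perms N) (lap N g) = l2 (perms N) (\<lambda>\<pi>. \<Sum>p\<in>B. g \<pi> - g (\<pi> \<circ> swap (fst p) (snd p)))"
    unfolding lap_def using Bsub
    by (intro l2_cong refl sum.mono_neutral_cong_right) (auto simp: zero)
  also have "\<dots> \<le> (\<Sum>p\<in>B. l2 (perms N) (\<lambda>\<pi>. g \<pi> - g (\<pi> \<circ> swap (fst p) (snd p))))"
    by (rule l2_triangle_sum)
  also have "\<dots> \<le> (\<Sum>p\<in>B. 2 * l2 (perms N) g)"
  proof (rule sum_mono)
    fix p assume "p \<in> B"
    then have "l2 (perms N) (\<lambda>\<pi>. g (\<pi> \<circ> swap (fst p) (snd p))) = l2 (perms N) g"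
      by (intro l2_reindex bij_betw_comp_swap) (auto simp: B_def)
    then show "l2 (perms N) (\<lambda>\<pi>. g \<pi> - g (\<pi> \<circ> swap (fst p) (snd p))) \<le> 2 * l2 (perms N) g"
      using l2_diff_le[of "perms N" g "\<lambda>\<pi>. g (\<pi> \<circ> swap (fst p) (snd p))"] by simp
  qed
  also have "\<dots> = real (card B) * (2 * l2 (perms N) g)"
    by simp
  also have "\<dots> \<le> real (2 * J * N) * (2 * l2 (perms N) g)"
  proof -
    have "card B \<le> 2 * card a * N"
      unfolding B_def by (rule card_pairs_touching[OF assms(2)])
    also have "\<dots> \<le> 2 * J * N"
      using assms(3) by simp
    finally have "card B \<le> 2 * J * N" .
    then have "real (card B) \<le> real (2 * J * N)"
      by linarith
    then show ?thesis by (intro mult_right_mono) simp_all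
  qed
  finally show ?thesis by (simp add: algebra_simps)
qed

text \<open>The constant \<open>c\<close> depends on the decomposition of \<open>g\<close> into juntas, but the growth rate does not; log-convexity
  of \<open>m \<mapsto> \<parallel>L^m g\<parallel>\<close> for the self-adjoint operator \<open>L = lap N\<close> then eliminates \<open>c\<close>.\<close>

lemma l2_lap_pow_low_degree:
  assumes "low_degree J g"
  shows "\<exists>c\<ge>0. \<forall>m. l2 (perms N) ((lap N ^^ m) g) \<le> c * (4 * real J * real N) ^ m"
  using assms
proof (induction rule: low_degree.induct)
  case (junta a g)
  \<comment> \<open>All iterates are fixed by the same set \<open>a\<close>, so the bound for one
    application can be repeated with the same \<open>J\<close>.\<close>
  have "l2 (perms N) ((lap N ^^ m) g) \<le> l2 (perms N) g * (4 * real J * real N) ^ m" for m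
  proof (induction m)
    case (Suc m)
    have "l2 (perms N) ((lap N ^^ Suc m) g) \<le> (4 * real J * real N) * l2 (perms N) ((lap N ^^ m) g)"
      using l2_lap_fixed_by[OF fixed_by_lap_pow[OF determined_by_fixed_by[OF junta(3)]] junta(1,2)]
      by simp
    also have "\<dots> \<le> (4 * real J * real N) * (l2 (perms N) g * (4 * real J * real N) ^ m)"
      by (intro mult_left_mono Suc) simp
    finally show ?case by (simp add: algebra_simps)
  qed simp
  then show ?case by (intro exI[of _ "l2 (perms N) g"]) simp
next
  case (add g h)
  then obtain c d where
    "0 \<le> c" "\<And>m. l2 (perms N) ((lap N ^^ m) g) \<le> c * (4 * real J * real N) ^ m"
    "0 \<le> d" "\<And>m. l2 (perms N) ((lap N ^^ m) h) \<le> d * (4 * real J * real N) ^ m"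
    by blast
  then have "0 \<le> c + d"
    "l2 (perms N) ((lap N ^^ m) (\<lambda>\<pi>. g \<pi> + h \<pi>)) \<le> (c + d) * (4 * real J * real N) ^ m" for m
    unfolding lap_pow_add
    by (auto simp: distrib_right intro!: order_trans[OF l2_triangle] add_mono)
  then show ?case by blast
qed

text \<open>Convexity along powers of two gives \<open>(x 1 / x 0) ^ n \<le> x n / x 0\<close> for
  \<open>n = 2 ^ m\<close>. If \<open>x 1 / x 0\<close> exceeded \<open>r\<close>, the powers of
  \<open>x 1 / (r * x 0)\<close> would be unbounded, whereas the growth hypothesis bounds them by
  \<open>c / x 0\<close>.\<close>

lemma log_convex_growth:
  fixes x :: "nat \<Rightarrow> real"
  assumes nonneg: "\<And>n. 0 \<le> x n" and convex: "\<And>n. (x n)\<^sup>2 \<le> x 0 * x (2 * n)"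
    and growth: "\<And>n. x n \<le> c * r ^ n" and "0 < r"
  shows "x 1 \<le> r * x 0"
proof (cases "x 0 = 0")
  case True
  then show ?thesis using convex[of 1] by simp
next
  case False
  then have x0: "0 < x 0" using nonneg[of 0] by simp
  show ?thesis
  proof (rule ccontr)
    assume "\<not> ?thesis"
    then have q: "1 < x 1 / (r * x 0)"
      using x0 \<open>0 < r\<close> by simp
    have pow: "(x 1 / x 0) ^ (2 ^ m) \<le> x (2 ^ m) / x 0" for m
    proof (induction m)
      case (Suc m)
      have "(x 1 / x 0) ^ (2 ^ Suc m) = ((x 1 / x 0) ^ (2 ^ m))\<^sup>2"
        by (simp add: power_mult[symmetric] mult.commute)
      also have "\<dots> \<le> (x (2 ^ m) / x 0)\<^sup>2"
        using Suc nonneg by (intro power_mono) simp_all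
      also have "\<dots> = (x (2 ^ m))\<^sup>2 / (x 0)\<^sup>2"
        by (simp add: power_divide)
      also have "\<dots> \<le> (x 0 * x (2 ^ Suc m)) / (x 0)\<^sup>2"
        using convex[of "2 ^ m"] by (intro divide_right_mono) simp_all
      also have "\<dots> = x (2 ^ Suc m) / x 0"
        using x0 by (simp add: power2_eq_square)
      finally show ?case .
    qed simp
    have bound: "(x 1 / (r * x 0)) ^ (2 ^ m) \<le> c / x 0" for m
    proof -
      have "(x 1 / (r * x 0)) ^ (2 ^ m) = (x 1 / x 0) ^ (2 ^ m) / r ^ (2 ^ m)"
        by (simp add: power_divide power_mult_distrib)
      also have "\<dots> \<le> (c * r ^ (2 ^ m) / x 0) / r ^ (2 ^ m)"
        using order_trans[OF pow[of m] divide_right_mono[OF growth[of "2 ^ m"]]] x0 \<open>0 < r\<close>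
        by (intro divide_right_mono) simp_all
      also have "\<dots> = c / x 0"
        using \<open>0 < r\<close> by simp
      finally show ?thesis .
    qed
    obtain n where n: "c / x 0 < (x 1 / (r * x 0)) ^ n"
      using real_arch_pow[OF q] by blast
    have "n \<le> 2 ^ n" by (simp add: less_imp_le)
    then have "(x 1 / (r * x 0)) ^ n \<le> (x 1 / (r * x 0)) ^ (2 ^ n)"
      using q by (intro power_increasing) auto
    then show False using n bound[of n] by linarith
  qed
qed

text \<open>A sum of many juntas obeys the bound of a single junta, without loss in the number of
  summands. In effect this bounds the eigenvalues of \<open>lap N\<close> that occur in functions of
  degree \<open>J\<close>.\<close>

lemma l2_lap_low_degree:
  assumes "low_degree J g" "0 < J" "0 < N"
  shows "l2 (perms N) (lap N g) \<le> (4 * real J * real N) * l2 (perms N) g"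
proof -
  obtain c where "\<And>m. l2 (perms N) ((lap N ^^ m) g) \<le> c * (4 * real J * real N) ^ m"
    using l2_lap_pow_low_degree[OF assms(1)] by blast
  then show ?thesis
    using log_convex_growth[of "\<lambda>m. l2 (perms N) ((lap N ^^ m) g)" c "4 * real J * real N"]
      l2_lap_pow_log_convex[of N _ g] assms(2,3) by simp
qed

text \<open>The left side is twice the inner product of \<open>g\<close> with
  \<open>lap N g\<close>, whence 8 as twice the 4 of the operator bound. Averaged over the
  \<open>N * N\<close> pairs, a function of degree \<open>J\<close> moves in mean square by at most
  \<open>8 * J / N\<close> times its squared norm.\<close>

lemma transposition_energy:
  assumes "low_degree J g" "0 < J" "0 < N"
  shows "(\<Sum>(i, j)\<in>{..<N} \<times> {..<N}. \<Sum>\<pi>\<in>perms N. (cmod (g \<pi> - g (\<pi> \<circ> swap i j)))\<^sup>2)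
    \<le> 8 * real J * real N * (\<Sum>\<pi>\<in>perms N. (cmod (g \<pi>))\<^sup>2)"
proof -
  \<comment> \<open>Both squared terms of the expansion have the same sum over
    \<open>perms N\<close>, by translation invariance.\<close>
  have pair: "(\<Sum>\<pi>\<in>perms N. (cmod (g \<pi> - g (\<pi> \<circ> swap i j)))\<^sup>2)
      = 2 * Re (\<Sum>\<pi>\<in>perms N. cnj (g \<pi>) * (g \<pi> - g (\<pi> \<circ> swap i j)))" if "i < N" "j < N" for i j
  proof -
    have "(cmod (g \<pi> - g (\<pi> \<circ> swap i j)))\<^sup>2 =
        (cmod (g \<pi>))\<^sup>2 + (cmod (g (\<pi> \<circ> swap i j)))\<^sup>2 - 2 * Re (cnj (g \<pi>) * g (\<pi> \<circ> swap i j))" for \<pi>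
      unfolding cmod_power2 by (simp add: power2_eq_square algebra_simps)
    then have "(\<Sum>\<pi>\<in>perms N. (cmod (g \<pi> - g (\<pi> \<circ> swap i j)))\<^sup>2)
        = (\<Sum>\<pi>\<in>perms N. (cmod (g \<pi>))\<^sup>2) + (\<Sum>\<pi>\<in>perms N. (cmod (g (\<pi> \<circ> swap i j)))\<^sup>2)
          - 2 * (\<Sum>\<pi>\<in>perms N. Re (cnj (g \<pi>) * g (\<pi> \<circ> swap i j)))"
      by (simp add: sum.distrib sum_subtractf sum_distrib_left)
    also have "(\<Sum>\<pi>\<in>perms N. (cmod (g (\<pi> \<circ> swap i j)))\<^sup>2) = (\<Sum>\<pi>\<in>perms N. (cmod (g \<pi>))\<^sup>2)"
      using sum_comp_swap[OF that, of "\<lambda>\<pi>. (cmod (g \<pi>))\<^sup>2"] .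
    also have "(\<Sum>\<pi>\<in>perms N. (cmod (g \<pi>))\<^sup>2) = (\<Sum>\<pi>\<in>perms N. Re (cnj (g \<pi>) * g \<pi>))"
      by (intro sum.cong refl) (simp add: cmod_power2, simp add: power2_eq_square)
    finally show ?thesis
      by (simp add: o_def right_diff_distrib sum_subtractf sum_distrib_left sum.distrib)
  qed
  have "(\<Sum>(i, j)\<in>{..<N} \<times> {..<N}. \<Sum>\<pi>\<in>perms N. (cmod (g \<pi> - g (\<pi> \<circ> swap i j)))\<^sup>2)
      = 2 * Re (\<Sum>(i, j)\<in>{..<N} \<times> {..<N}. \<Sum>\<pi>\<in>perms N. cnj (g \<pi>) * (g \<pi> - g (\<pi> \<circ> swap i j)))"
    unfolding Re_sum sum_distrib_left
    using pair
    by (intro sum.cong refl) (auto simp: sum_distrib_left)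
  also have "(\<Sum>(i, j)\<in>{..<N} \<times> {..<N}. \<Sum>\<pi>\<in>perms N. cnj (g \<pi>) * (g \<pi> - g (\<pi> \<circ> swap i j)))
      = (\<Sum>\<pi>\<in>perms N. cnj (g \<pi>) * lap N g \<pi>)"
    unfolding lap_def sum_distrib_left
    by (subst sum.swap) (simp add: case_prod_unfold)
  also have "Re (\<Sum>\<pi>\<in>perms N. cnj (g \<pi>) * lap N g \<pi>) \<le> l2 (perms N) (\<lambda>\<pi>. cnj (g \<pi>)) * l2 (perms N) (lap N g)"
    by (rule order_trans[OF complex_Re_le_cmod l2_Cauchy_Schwarz])
  also have "\<dots> \<le> l2 (perms N) g * ((4 * real J * real N) * l2 (perms N) g)"
    using l2_lap_low_degree[OF assms] by (simp add: mult_left_mono)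
  also have "\<dots> = 4 * real J * real N * (\<Sum>\<pi>\<in>perms N. (cmod (g \<pi>))\<^sup>2)"
    unfolding l2_power2[symmetric] by (simp add: power2_eq_square)
  finally show ?thesis by (simp add: o_def mult.assoc)
qed

section \<open>Queries and circuits\<close>

text \<open>Basis indices are mixed-radix numbers with digits control, query input, query output and
  a remainder below \<open>R\<close>; this reads the query input. \<open>R\<close> stands for advice
  and ancilla together.\<close>

definition reg :: "nat \<Rightarrow> nat \<Rightarrow> nat \<Rightarrow> nat" where
  "reg N R i = (i div (N * R)) mod N"

definition query_mat :: "nat \<Rightarrow> nat \<Rightarrow> nat monoid \<Rightarrow> (nat \<Rightarrow> nat) \<Rightarrow> complex Matrix.mat" where
  "query_mat N R G f = kron (controlled_query N G f) (1\<^sub>m R)"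

text \<open>The map on basis indices behind the controlled query. It is a bijection for every
  \<open>f\<close> from \<open>{..<N}\<close> to itself, injective or not, as is required for
  planted functions, where \<open>y\<close> can have two preimages.\<close>

definition cquery_step :: "nat \<Rightarrow> nat monoid \<Rightarrow> (nat \<Rightarrow> nat) \<Rightarrow> nat \<Rightarrow> nat" where
  "cquery_step N G f n =
    (if n div (N * N) = 1
     then N * N + ((n mod (N * N)) div N * N + (n mod (N * N) mod N) \<otimes>\<^bsub>G\<^esub> f ((n mod (N * N)) div N))
     else n)"

definition query_step :: "nat \<Rightarrow> nat \<Rightarrow> nat monoid \<Rightarrow> (nat \<Rightarrow> nat) \<Rightarrow> nat \<Rightarrow> nat" where
  "query_step N R G f j = cquery_step N G f (j div R) * R + j mod R"

definition qdim :: "nat \<Rightarrow> nat \<Rightarrow> nat" where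
  "qdim N R = 2 * (N * N) * R"

lemma eq_digits_iff: "r < b \<Longrightarrow> i = a * b + r \<longleftrightarrow> i div b = a \<and> i mod b = (r::nat)"
  by auto

lemma digits_eq:
  assumes "a * b + r = a' * b + r'" "r < b" "r' < (b::nat)"
  shows "a = a'" "r = r'"
  using eq_digits_iff[OF assms(2), of "a * b + r" a] eq_digits_iff[OF assms(3), of "a * b + r" a'] assms(1)
  by simp_all

lemma div_mod_eqI: "m div b = n div b \<Longrightarrow> m mod b = n mod b \<Longrightarrow> m = (n::nat)"
  by (metis div_mult_mod_eq)

lemma div_less_mult: "i < a * b \<Longrightarrow> i div b < (a::nat)"
  by (simp add: less_mult_imp_div_less)

lemma digits_less: "a < m \<Longrightarrow> b < n \<Longrightarrow> a * n + b < m * (n::nat)"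
proof -
  assume "a < m" "b < n"
  then have "a * n + b < a * n + n" by simp
  also have "\<dots> = Suc a * n" by simp
  also have "\<dots> \<le> m * n" using \<open>a < m\<close> by (intro mult_right_mono) auto
  finally show ?thesis .
qed

locale query_setup =
  fixes N R :: nat and G :: "nat monoid"
  assumes N_pos: "0 < N" and R_pos: "0 < R"
    and G_group: "group G" and G_carrier: "carrier G = {..<N}"
begin

interpretation G: group G by (rule G_group)

abbreviation d where "d \<equiv> qdim N R"

section \<open>The controlled query as a permutation matrix\<close>

lemma mult_less: "z < N \<Longrightarrow> w < N \<Longrightarrow> z \<otimes>\<^bsub>G\<^esub> w < N"
  using G.m_closed[of z w] by (simp add: G_carrier)

lemma mult_cancel: "z < N \<Longrightarrow> z' < N \<Longrightarrow> w < N \<Longrightarrow> z \<otimes>\<^bsub>G\<^esub> w = z' \<otimes>\<^bsub>G\<^esub> w \<longleftrightarrow> z = z'"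
  using G.right_cancel[of w z z'] by (auto simp: G_carrier)

lemma input_less: "(n mod (N * N)) div N < N"
  using N_pos by (intro div_less_mult) simp

lemma cquery_less:
  assumes "\<And>x. x < N \<Longrightarrow> f x < N"
  shows "((n mod (N * N)) div N) * N + (n mod (N * N) mod N) \<otimes>\<^bsub>G\<^esub> f ((n mod (N * N)) div N) < N * N"
  using N_pos by (intro digits_less mult_less assms input_less) auto

text \<open>Stated for arbitrary \<open>f\<close>, so that the dependence on \<open>f\<close> can be
  read off in the generality of \<open>determined_by\<close>, whose functions may leave
  \<open>{..<N}\<close>.\<close>

lemma cquery_digits:
  assumes m: "m < 2 * (N * N)" and n: "n < 2 * (N * N)"
  shows "controlled_query N G f $$ (m, n) =
    (if m div (N * N) = 0 \<and> n div (N * N) = 0 then (if m mod (N * N) = n mod (N * N) then 1 else 0) else 0) +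
    (if m div (N * N) = 1 \<and> n div (N * N) = 1 then
      (if (m mod (N * N)) div N = (n mod (N * N)) div N \<and>
          (m mod (N * N)) mod N = (n mod (N * N) mod N) \<otimes>\<^bsub>G\<^esub> f ((n mod (N * N)) div N) then 1 else 0) else 0)"
proof -
  have dims: "dim_row (kron (basis_proj 2 b) A) = 2 * dim_row A"
    "dim_col (kron (basis_proj 2 b) A) = 2 * dim_col A" for b A
    by (simp_all add: kron_def basis_proj_def)
  have q: "dim_row (query_unitary N G f) = N * N" "dim_col (query_unitary N G f) = N * N"
    by (simp_all add: query_unitary_def)
  have lt: "m div (N * N) < 2" "n div (N * N) < 2" "m mod (N * N) < N * N" "n mod (N * N) < N * N"
    using m n N_pos by (auto intro: div_less_mult)
  have kr: "kron (basis_proj 2 b) A $$ (m, n) =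
      (if m div (N * N) = b \<and> n div (N * N) = b then A $$ (m mod (N * N), n mod (N * N)) else 0)"
    if "A \<in> carrier_mat (N * N) (N * N)" for A b
    using that m n lt unfolding kron_def basis_proj_def by simp
  have qc: "query_unitary N G f \<in> carrier_mat (N * N) (N * N)"
    using q by auto
  show ?thesis
    using m n lt kr[OF one_carrier_mat] kr[OF qc] unfolding controlled_query_def
    by (simp add: dims q) (simp add: query_unitary_def)
qed

lemma cquery_index:
  assumes f: "\<And>x. x < N \<Longrightarrow> f x < N" and m: "m < 2 * (N * N)" and n: "n < 2 * (N * N)"
  shows "controlled_query N G f $$ (m, n) = (if m = cquery_step N G f n then 1 else 0)"
proof (cases "n div (N * N) = 1")
  case True
  have z: "(n mod (N * N) mod N) \<otimes>\<^bsub>G\<^esub> f ((n mod (N * N)) div N) < N"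
    using N_pos by (intro mult_less f input_less) auto
  have "m = cquery_step N G f n \<longleftrightarrow> m div (N * N) = 1 \<and>
      m mod (N * N) = (n mod (N * N)) div N * N + (n mod (N * N) mod N) \<otimes>\<^bsub>G\<^esub> f ((n mod (N * N)) div N)"
    using eq_digits_iff[OF cquery_less[of f n, OF f], of m 1] True
    by (simp add: cquery_step_def)
  also have "\<dots> \<longleftrightarrow> m div (N * N) = 1 \<and> (m mod (N * N)) div N = (n mod (N * N)) div N \<and>
      (m mod (N * N)) mod N = (n mod (N * N) mod N) \<otimes>\<^bsub>G\<^esub> f ((n mod (N * N)) div N)"
    using eq_digits_iff[OF z] by auto
  finally show ?thesis using True unfolding cquery_digits[OF m n] by simp
next
  case False
  have "n div (N * N) < 2" using n by (rule div_less_mult)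
  then have n0: "n div (N * N) = 0" using False by linarith
  have "m = n \<longleftrightarrow> m div (N * N) = n div (N * N) \<and> m mod (N * N) = n mod (N * N)"
    using div_mod_eqI by blast
  then show ?thesis using False n0 unfolding cquery_digits[OF m n] by (auto simp: cquery_step_def)
qed

lemma cquery_step_less:
  assumes f: "\<And>x. x < N \<Longrightarrow> f x < N" and n: "n < 2 * (N * N)"
  shows "cquery_step N G f n < 2 * (N * N)"
  using cquery_less[of f n, OF f] n by (auto simp: cquery_step_def)

text \<open>Control and input are left alone, so they agree for both indices; the output is then
  recovered by cancelling the common group element.\<close>

lemma cquery_step_inj:
  assumes f: "\<And>x. x < N \<Longrightarrow> f x < N" and n: "n < 2 * (N * N)" and n': "n' < 2 * (N * N)"
    and eq: "cquery_step N G f n = cquery_step N G f n'"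
  shows "n = n'"
proof -
  have c: "cquery_step N G f k div (N * N) = k div (N * N)" if "k < 2 * (N * N)" for k
    using cquery_less[of f k, OF f] N_pos by (simp add: cquery_step_def)
  have cc: "n div (N * N) = n' div (N * N)"
    using c[OF n] c[OF n'] eq by simp
  show ?thesis
  proof (cases "n div (N * N) = 1")
    case True
    let ?z = "\<lambda>n. (n mod (N * N) mod N) \<otimes>\<^bsub>G\<^esub> f ((n mod (N * N)) div N)"
    have z: "?z n < N" for n
      using N_pos by (intro mult_less f input_less) auto
    have "(n mod (N * N)) div N * N + ?z n = (n' mod (N * N)) div N * N + ?z n'"
      using eq True cc by (simp add: cquery_step_def)
    then have "(n mod (N * N)) div N = (n' mod (N * N)) div N" "?z n = ?z n'"
      using digits_eq[OF _ z z] by blast+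
    moreover from this have "n mod (N * N) mod N = n' mod (N * N) mod N"
      using mult_cancel f input_less N_pos by simp
    ultimately have "n mod (N * N) = n' mod (N * N)"
      using div_mod_eqI by blast
    with cc show ?thesis by (rule div_mod_eqI)
  next
    case False
    then show ?thesis using eq cc by (simp add: cquery_step_def)
  qed
qed

lemma query_mat_digits:
  assumes "i < d" "j < d"
  shows "query_mat N R G f $$ (i, j)
    = controlled_query N G f $$ (i div R, j div R) * (if i mod R = j mod R then 1 else 0)"
proof -
  have "dim_row (controlled_query N G f) = 2 * (N * N)" "dim_col (controlled_query N G f) = 2 * (N * N)"
    by (simp_all add: controlled_query_def kron_def basis_proj_def query_unitary_def)
  then show ?thesis
    using assms R_pos unfolding query_mat_def kron_def by (simp add: qdim_def)
qed

lemma div_R_less: "i < d \<Longrightarrow> i div R < 2 * (N * N)"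
  by (auto simp: qdim_def intro: div_less_mult)

lemma query_index:
  assumes f: "\<And>x. x < N \<Longrightarrow> f x < N" and i: "i < d" and j: "j < d"
  shows "query_mat N R G f $$ (i, j) = (if i = query_step N R G f j then 1 else 0)"
  using eq_digits_iff[of "j mod R" R i "cquery_step N G f (j div R)"] R_pos
    cquery_index[of f, OF f div_R_less[OF i] div_R_less[OF j]]
  by (simp add: query_mat_digits[OF i j] query_step_def)

lemma query_step_bij:
  assumes f: "\<And>x. x < N \<Longrightarrow> f x < N"
  shows "bij_betw (query_step N R G f) {..<d} {..<d}"
proof -
  have "query_step N R G f ` {..<d} \<subseteq> {..<d}"
    using R_pos cquery_step_less[OF f div_R_less] by (auto simp: query_step_def qdim_def intro!: digits_less)
  moreover have "inj_on (query_step N R G f) {..<d}"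
  proof (rule inj_onI)
    fix i j assume ij: "i \<in> {..<d}" "j \<in> {..<d}" and eq: "query_step N R G f i = query_step N R G f j"
    have "cquery_step N G f (i div R) = cquery_step N G f (j div R)" "i mod R = j mod R"
      using digits_eq[OF eq[unfolded query_step_def]] R_pos by simp_all
    then have "i div R = j div R"
      using cquery_step_inj[OF f div_R_less div_R_less] ij by simp
    then show "i = j"
      using \<open>i mod R = j mod R\<close> by (rule div_mod_eqI)
  qed
  ultimately show ?thesis
    by (simp add: bij_betw_def endo_inj_surj)
qed

lemma reg_less: "reg N R i < N"
  using N_pos by (simp add: reg_def)

lemma reg_alt: "reg N R j = ((j div R) mod (N * N)) div N"
proof -
  have "(j div R) mod (N * N) div N = (j div R div N) mod N"
    using N_pos by (simp add: mod_mult2_eq)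
  then show ?thesis
    by (simp add: reg_def div_mult2_eq[symmetric] mult.commute)
qed

text \<open>This makes every entry of the query matrix a junta on one point, the source of all
  degree bounds for circuits.\<close>

lemma query_mat_cong:
  assumes "i < d" "j < d" "f (reg N R j) = g (reg N R j)"
  shows "query_mat N R G f $$ (i, j) = query_mat N R G g $$ (i, j)"
  using assms(3)
  by (simp add: query_mat_digits[OF assms(1,2)] cquery_digits[OF div_R_less[OF assms(1)] div_R_less[OF assms(2)]] reg_alt)

lemma query_step_cong:
  assumes "f (reg N R j) = g (reg N R j)"
  shows "query_step N R G f j = query_step N R G g j"
  using assms by (simp add: query_step_def cquery_step_def reg_alt)

lemma query_step_less: "(\<And>x. x < N \<Longrightarrow> f x < N) \<Longrightarrow> j < d \<Longrightarrow> query_step N R G f j < d"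
  using query_step_bij[of f] by (auto simp: bij_betw_def)

end

section \<open>Runs of a circuit on state vectors\<close>

definition apply_mat :: "nat \<Rightarrow> complex Matrix.mat \<Rightarrow> (nat \<Rightarrow> complex) \<Rightarrow> nat \<Rightarrow> complex" where
  "apply_mat d M \<psi> i = (\<Sum>j<d. M $$ (i, j) * \<psi> j)"

text \<open>Vector counterpart of \<open>circuit\<close>, giving the states between queries that the
  hybrid argument compares. Vectors are plain functions, of which only the values below
  \<open>d\<close> matter.\<close>

primrec run :: "nat \<Rightarrow> complex Matrix.mat \<Rightarrow> (nat \<Rightarrow> complex Matrix.mat) \<Rightarrow> (nat \<Rightarrow> complex) \<Rightarrow> nat \<Rightarrow> nat \<Rightarrow> complex" where
  "run d Q U v 0 = apply_mat d (U 0) v"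
| "run d Q U v (Suc t) = apply_mat d (U (Suc t)) (apply_mat d Q (run d Q U v t))"

lemma apply_mat_cong: "(\<And>j. j < d \<Longrightarrow> \<psi> j = \<phi> j) \<Longrightarrow> apply_mat d M \<psi> i = apply_mat d M \<phi> i"
  unfolding apply_mat_def by (intro sum.cong) auto

lemma apply_mat_diff:
  "apply_mat d M (\<lambda>j. \<psi> j - \<phi> j) = (\<lambda>i. apply_mat d M \<psi> i - apply_mat d M \<phi> i)"
  unfolding apply_mat_def by (simp add: right_diff_distrib sum_subtractf)

lemma apply_mat_mult:
  assumes "A \<in> carrier_mat d d" "B \<in> carrier_mat d d" "i < d"
  shows "apply_mat d (A * B) \<psi> i = apply_mat d A (apply_mat d B \<psi>) i"
proof -
  have "apply_mat d (A * B) \<psi> i = (\<Sum>j<d. (\<Sum>k<d. A $$ (i, k) * B $$ (k, j)) * \<psi> j)"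
    using assms by (simp add: apply_mat_def scalar_prod_def lessThan_atLeast0)
  also have "\<dots> = (\<Sum>k<d. A $$ (i, k) * (\<Sum>j<d. B $$ (k, j) * \<psi> j))"
    unfolding sum_distrib_right sum_distrib_left by (subst sum.swap) (simp add: mult.assoc)
  finally show ?thesis by (simp add: apply_mat_def)
qed

lemma circuit_carrier:
  assumes "Q \<in> carrier_mat d d" "\<And>k. k \<le> t \<Longrightarrow> U k \<in> carrier_mat d d"
  shows "circuit Q U t \<in> carrier_mat d d"
  using assms(2)
proof (induction t)
  case (Suc t)
  then show ?case using assms(1) by (auto intro!: mult_carrier_mat)
qed simp

lemma apply_circuit:
  assumes "Q \<in> carrier_mat d d" "\<And>k. k \<le> t \<Longrightarrow> U k \<in> carrier_mat d d" "i < d"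
  shows "apply_mat d (circuit Q U t) v i = run d Q U v t i"
  using assms(2,3)
proof (induction t arbitrary: i)
  case (Suc t)
  have c: "circuit Q U t \<in> carrier_mat d d"
    using Suc.prems by (intro circuit_carrier assms(1)) auto
  have "apply_mat d (circuit Q U (Suc t)) v i = apply_mat d (U (Suc t)) (apply_mat d (Q * circuit Q U t) v) i"
    using Suc.prems c assms(1) by (simp add: apply_mat_mult[OF _ mult_carrier_mat])
  also have "\<dots> = apply_mat d (U (Suc t)) (apply_mat d Q (run d Q U v t)) i"
  proof (rule apply_mat_cong)
    fix j assume j: "j < d"
    have "apply_mat d (Q * circuit Q U t) v j = apply_mat d Q (apply_mat d (circuit Q U t) v) j"
      by (rule apply_mat_mult[OF assms(1) c j])
    also have "\<dots> = apply_mat d Q (run d Q U v t) j"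
      using Suc by (intro apply_mat_cong) auto
    finally show "apply_mat d (Q * circuit Q U t) v j = apply_mat d Q (run d Q U v t) j" .
  qed
  finally show ?case by simp
qed simp

lemma mat_adjoint_index:
  assumes "A \<in> carrier_mat n m" "i < m" "j < n"
  shows "mat_adjoint A $$ (i, j) = cnj (A $$ (j, i))"
  using assms unfolding mat_adjoint_def by (simp add: mat_of_rows_def)

lemma mat_adjoint_carrier: "A \<in> carrier_mat n m \<Longrightarrow> mat_adjoint A \<in> carrier_mat m n"
  unfolding mat_adjoint_def by auto

text \<open>Expanding the squared norm leaves inner products of columns of \<open>U\<close>, which
  are orthonormal by \<open>mat_adjoint U * U = 1\<^sub>m d\<close>.\<close>

lemma l2_unitary:
  assumes "unitary_mat d U"
  shows "l2 {..<d} (apply_mat d U \<psi>) = l2 {..<d} \<psi>"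
proof -
  have U: "U \<in> carrier_mat d d" and UU: "mat_adjoint U * U = 1\<^sub>m d"
    using assms by (auto simp: unitary_mat_def)
  have orth: "(\<Sum>i<d. cnj (U $$ (i, j)) * U $$ (i, k)) = (if j = k then 1 else 0)" if "j < d" "k < d" for j k
  proof -
    have "(mat_adjoint U * U) $$ (j, k) = (\<Sum>i<d. cnj (U $$ (i, j)) * U $$ (i, k))"
      using that U mat_adjoint_carrier[OF U]
      by (simp add: scalar_prod_def lessThan_atLeast0 mat_adjoint_index[OF U])
    then show ?thesis using that by (simp add: UU)
  qed
  have "complex_of_real ((l2 {..<d} (apply_mat d U \<psi>))\<^sup>2)
      = (\<Sum>i<d. (\<Sum>j<d. cnj (U $$ (i, j)) * cnj (\<psi> j)) * (\<Sum>k<d. U $$ (i, k) * \<psi> k))"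
    by (simp add: l2_power2 complex_norm_square mult.commute apply_mat_def del: of_real_power)
  also have "\<dots> = (\<Sum>i<d. \<Sum>j<d. \<Sum>k<d. cnj (\<psi> j) * \<psi> k * (cnj (U $$ (i, j)) * U $$ (i, k)))"
    unfolding sum_product by (simp add: mult_ac)
  also have "\<dots> = (\<Sum>j<d. \<Sum>k<d. \<Sum>i<d. cnj (\<psi> j) * \<psi> k * (cnj (U $$ (i, j)) * U $$ (i, k)))"
    by (rule trans[OF sum.swap sum.cong[OF refl sum.swap]])
  also have "\<dots> = (\<Sum>j<d. \<Sum>k<d. cnj (\<psi> j) * \<psi> k * (if j = k then 1 else 0))"
    unfolding sum_distrib_left[symmetric] by (intro sum.cong refl) (simp add: orth)
  also have "\<dots> = (\<Sum>j<d. cnj (\<psi> j) * \<psi> j)"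
    by (intro sum.cong refl) (simp add: if_distrib cong: if_cong)
  also have "\<dots> = complex_of_real ((l2 {..<d} \<psi>)\<^sup>2)"
    by (simp add: l2_power2 complex_norm_square mult.commute del: of_real_power)
  finally have "(l2 {..<d} (apply_mat d U \<psi>))\<^sup>2 = (l2 {..<d} \<psi>)\<^sup>2"
    by (simp only: of_real_eq_iff)
  then show ?thesis by (simp add: power2_eq_iff_nonneg)
qed

context query_setup
begin

lemma query_mat_carrier: "query_mat N R G f \<in> carrier_mat d d"
  by (rule carrier_matI) (simp_all add: query_mat_def kron_def controlled_query_def basis_proj_def query_unitary_def qdim_def)

lemma apply_query_step:
  assumes f: "\<And>x. x < N \<Longrightarrow> f x < N" and j: "j < d"
  shows "apply_mat d (query_mat N R G f) \<psi> (query_step N R G f j) = \<psi> j"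
proof -
  have "query_mat N R G f $$ (query_step N R G f j, k) = (if k = j then 1 else 0)" if "k < d" for k
    using query_index[of f "query_step N R G f j" k, OF f query_step_less[of f, OF f j] that]
      inj_on_eq_iff[OF bij_betw_imp_inj_on[OF query_step_bij[of f, OF f]], of j k] that j
    by auto
  then have "apply_mat d (query_mat N R G f) \<psi> (query_step N R G f j) = (\<Sum>k<d. if k = j then \<psi> k else 0)"
    unfolding apply_mat_def by (intro sum.cong) auto
  then show ?thesis using j by simp
qed

lemma l2_query:
  assumes f: "\<And>x. x < N \<Longrightarrow> f x < N"
  shows "l2 {..<d} (apply_mat d (query_mat N R G f) \<psi>) = l2 {..<d} \<psi>"
proof -
  have "l2 {..<d} (apply_mat d (query_mat N R G f) \<psi>)
      = l2 {..<d} (\<lambda>j. apply_mat d (query_mat N R G f) \<psi> (query_step N R G f j))"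
    using l2_reindex[OF query_step_bij[of f, OF f]] by simp
  also have "\<dots> = l2 {..<d} \<psi>"
    by (intro l2_cong refl) (simp add: apply_query_step[of f, OF f])
  finally show ?thesis .
qed

lemma l2_run:
  assumes f: "\<And>x. x < N \<Longrightarrow> f x < N" and U: "\<And>k. k \<le> t \<Longrightarrow> unitary_mat d (U k)"
  shows "l2 {..<d} (run d (query_mat N R G f) U v t) = l2 {..<d} v"
  using U by (induction t) (simp_all add: l2_unitary l2_query[of f, OF f])

lemma run_diff:
  "run d Q U (\<lambda>i. v i - w i) t = (\<lambda>i. run d Q U v t i - run d Q U w t i)"
  by (induction t) (simp_all add: apply_mat_diff)

text \<open>The two queries agree on all basis states whose input is not \<open>x\<close>, so
  \<open>\<psi>\<close> may be replaced by its part with input \<open>x\<close>. Both queries are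
  isometries on that part, whence the factor 2.\<close>

lemma query_mat_diff:
  assumes f: "\<And>x. x < N \<Longrightarrow> f x < N" and g: "\<And>x. x < N \<Longrightarrow> g x < N"
    and fg: "\<And>k. k \<noteq> x \<Longrightarrow> f k = g k"
  shows "l2 {..<d} (\<lambda>i. apply_mat d (query_mat N R G f) \<psi> i - apply_mat d (query_mat N R G g) \<psi> i)
    \<le> 2 * l2 {i. i < d \<and> reg N R i = x} \<psi>"
proof -
  let ?\<phi> = "\<lambda>j. if reg N R j = x then \<psi> j else 0"
  have eq: "apply_mat d (query_mat N R G f) \<psi> i - apply_mat d (query_mat N R G g) \<psi> i
      = apply_mat d (query_mat N R G f) ?\<phi> i - apply_mat d (query_mat N R G g) ?\<phi> i" if "i < d" for i
    unfolding apply_mat_def sum_subtractf[symmetric]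
  proof (intro sum.cong refl)
    fix j assume "j \<in> {..<d}"
    then have j: "j < d" by simp
    show "query_mat N R G f $$ (i, j) * \<psi> j - query_mat N R G g $$ (i, j) * \<psi> j
      = query_mat N R G f $$ (i, j) * ?\<phi> j - query_mat N R G g $$ (i, j) * ?\<phi> j"
      using query_index[of f i j, OF f that j] query_index[of g i j, OF g that j]
        query_step_cong[of f j g] fg by auto
  qed
  have "l2 {..<d} ?\<phi> = l2 {i. i < d \<and> reg N R i = x} \<psi>"
    unfolding l2_def L2_set_def by (intro arg_cong[where f = sqrt] sum.mono_neutral_cong_right) auto
  then have b: "l2 {..<d} (apply_mat d (query_mat N R G h) ?\<phi>) = l2 {i. i < d \<and> reg N R i = x} \<psi>"
    if "\<And>x. x < N \<Longrightarrow> h x < N" for h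
    using l2_query[of h, OF that] by simp
  have "l2 {..<d} (\<lambda>i. apply_mat d (query_mat N R G f) \<psi> i - apply_mat d (query_mat N R G g) \<psi> i)
      = l2 {..<d} (\<lambda>i. apply_mat d (query_mat N R G f) ?\<phi> i - apply_mat d (query_mat N R G g) ?\<phi> i)"
    by (intro l2_cong refl eq) simp
  also have "\<dots> \<le> l2 {i. i < d \<and> reg N R i = x} \<psi> + l2 {i. i < d \<and> reg N R i = x} \<psi>"
    by (rule order_trans[OF l2_diff_le]) (simp add: b[of f, OF f] b[of g, OF g])
  finally show ?thesis by simp
qed

text \<open>Both runs start from the same \<open>v\<close>. Each query adds at most twice the
  amplitude that the run on \<open>g\<close> places on the input \<open>x\<close>, and the
  isometries that follow do not amplify the error.\<close>

lemma hybrid: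
  assumes f: "\<And>x. x < N \<Longrightarrow> f x < N" and g: "\<And>x. x < N \<Longrightarrow> g x < N"
    and fg: "\<And>k. k \<noteq> x \<Longrightarrow> f k = g k" and U: "\<And>k. k \<le> t \<Longrightarrow> unitary_mat d (U k)"
  shows "l2 {..<d} (\<lambda>i. run d (query_mat N R G f) U v t i - run d (query_mat N R G g) U v t i)
    \<le> 2 * (\<Sum>s<t. l2 {i. i < d \<and> reg N R i = x} (run d (query_mat N R G g) U v s))"
  using U
proof (induction t)
  case 0
  then show ?case by (simp add: l2_def L2_set_def)
next
  case (Suc t)
  let ?a = "run d (query_mat N R G f) U v t" and ?b = "run d (query_mat N R G g) U v t"
  let ?Qf = "apply_mat d (query_mat N R G f)" and ?Qg = "apply_mat d (query_mat N R G g)"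
  have "l2 {..<d} (\<lambda>i. run d (query_mat N R G f) U v (Suc t) i - run d (query_mat N R G g) U v (Suc t) i)
      = l2 {..<d} (\<lambda>i. ?Qf ?a i - ?Qg ?b i)"
    unfolding run.simps apply_mat_diff[symmetric] by (rule l2_unitary) (simp add: Suc.prems)
  \<comment> \<open>Adding and subtracting the query to \<open>f\<close> on the state of the run on
    \<open>g\<close> separates the inherited error from the error of this query.\<close>
  also have "\<dots> = l2 {..<d} (\<lambda>i. ?Qf (\<lambda>j. ?a j - ?b j) i + (?Qf ?b i - ?Qg ?b i))"
    by (simp add: apply_mat_diff)
  also have "\<dots> \<le> l2 {..<d} (?Qf (\<lambda>j. ?a j - ?b j)) + l2 {..<d} (\<lambda>i. ?Qf ?b i - ?Qg ?b i)"
    by (rule l2_triangle)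
  also have "\<dots> \<le> l2 {..<d} (\<lambda>j. ?a j - ?b j) + 2 * l2 {i. i < d \<and> reg N R i = x} ?b"
    using l2_query[of f, OF f] query_mat_diff[of f g x, OF f g fg] by simp
  also have "\<dots> \<le> 2 * (\<Sum>s<Suc t. l2 {i. i < d \<and> reg N R i = x} (run d (query_mat N R G g) U v s))"
    using Suc.IH Suc.prems by simp
  finally show ?case .
qed

end

section \<open>Inverting a permutation from a low-degree initial state\<close>

lemma sum4_square_le: "((a::real) + b + c + e)\<^sup>2 \<le> 4 * (a\<^sup>2 + b\<^sup>2 + c\<^sup>2 + e\<^sup>2)"
proof -
  have "4 * (a\<^sup>2 + b\<^sup>2 + c\<^sup>2 + e\<^sup>2) - (a + b + c + e)\<^sup>2
      = (a - b)\<^sup>2 + (a - c)\<^sup>2 + (a - e)\<^sup>2 + (b - c)\<^sup>2 + (b - e)\<^sup>2 + (c - e)\<^sup>2"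
    by (simp add: power2_eq_square algebra_simps)
  also have "\<dots> \<ge> 0" by simp
  finally show ?thesis by simp
qed

section \<open>Planting a second preimage\<close>

abbreviation perm_inv :: "(nat \<Rightarrow> nat) \<Rightarrow> nat \<Rightarrow> nat" where
  "perm_inv \<equiv> inv_into UNIV"

text \<open>Planting the value \<open>y\<close> at \<open>x\<close> in \<open>\<pi>\<close> gives the same function as planting it at \<open>perm_inv \<pi> y\<close> in the first component
  of \<open>plant_swap y (\<pi>, x)\<close>: from that function the true preimage and the planted one cannot be told apart.\<close>

definition plant_swap :: "nat \<Rightarrow> (nat \<Rightarrow> nat) \<times> nat \<Rightarrow> (nat \<Rightarrow> nat) \<times> nat" where
  "plant_swap y = (\<lambda>(\<pi>, x). (\<pi> \<circ> swap x (perm_inv \<pi> y), perm_inv \<pi> y))"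

lemma perms_value:
  assumes "\<pi> \<in> perms N"
  shows "x < N \<Longrightarrow> \<pi> x < N" "y < N \<Longrightarrow> perm_inv \<pi> y < N" "\<pi> (perm_inv \<pi> y) = y"
proof -
  have p: "\<pi> permutes {..<N}" using assms by simp
  show "x < N \<Longrightarrow> \<pi> x < N" using permutes_in_image[OF p, of x] by simp
  show "y < N \<Longrightarrow> perm_inv \<pi> y < N" using permutes_in_image[OF permutes_inv[OF p], of y] by simp
  show "\<pi> (perm_inv \<pi> y) = y" using permutes_inverses(1)[OF p] by simp
qed

lemma perms_inv_eq: "\<pi> \<in> perms N \<Longrightarrow> perm_inv \<pi> y = x \<longleftrightarrow> \<pi> x = y"
  using permutes_inv_eq[of \<pi> "{..<N}" y x] by auto

lemma comp_swap_perms: "\<pi> \<in> perms N \<Longrightarrow> i < N \<Longrightarrow> j < N \<Longrightarrow> \<pi> \<circ> swap i j \<in> perms N"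
  using bij_betw_comp_swap[of i N j] by (auto simp: bij_betw_def)

text \<open>\<open>plant_swap y\<close> is an involution: in the swapped permutation the preimage of
  \<open>y\<close> is \<open>x\<close>, and swapping the same two points again restores
  \<open>\<pi>\<close>. Uniform pairs \<open>(\<pi>, x)\<close> therefore stay uniform.\<close>

lemma plant_swap_bij:
  assumes "y < N"
  shows "bij_betw (plant_swap y) (perms N \<times> {..<N}) (perms N \<times> {..<N})"
proof -
  have inverse: "plant_swap y (plant_swap y (\<pi>, x)) = (\<pi>, x)" if "\<pi> \<in> perms N" "x < N" for \<pi> x
  proof -
    let ?\<sigma> = "\<pi> \<circ> swap x (perm_inv \<pi> y)"
    have "?\<sigma> \<in> perms N"
      using that assms by (intro comp_swap_perms perms_value(2)) auto
    then have "perm_inv ?\<sigma> y = x"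
      using perms_inv_eq[of ?\<sigma> N y x] perms_value(3)[OF that(1), of y] by simp
    moreover have "?\<sigma> \<circ> swap (perm_inv \<pi> y) x = \<pi>"
      by (simp add: fun_eq_iff transpose_commute)
    ultimately show ?thesis
      unfolding plant_swap_def prod.case by simp
  qed
  have "plant_swap y ` (perms N \<times> {..<N}) \<subseteq> perms N \<times> {..<N}"
  proof (rule image_subsetI)
    fix p assume "p \<in> perms N \<times> {..<N}"
    then obtain \<pi> x where p: "p = (\<pi>, x)" and \<pi>: "\<pi> \<in> perms N" and x: "x < N" by blast
    have lt: "perm_inv \<pi> y < N" using perms_value(2)[OF \<pi> assms] .
    show "plant_swap y p \<in> perms N \<times> {..<N}"
      using comp_swap_perms[OF \<pi> x lt] lt by (simp add: p plant_swap_def)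
  qed
  then show ?thesis
    using inverse by (intro bij_betw_byWitness[where f' = "plant_swap y"]) (simp_all add: split_paired_all)
qed

text \<open>On both sides \<open>x\<close> and \<open>x0\<close> carry the value \<open>y\<close>,
  and the old value at \<open>x\<close> is lost if the points differ.\<close>

lemma fun_upd_comp_swap:
  assumes "\<pi> x0 = y"
  shows "(\<pi> \<circ> swap x x0)(x0 := y) = \<pi>(x := y)"
  using assms by (auto simp: fun_eq_iff Transposition.transpose_def)

context query_setup
begin

text \<open>Four comparisons lead from the run on \<open>\<pi>\<close> to the run with
  \<open>y\<close> planted at \<open>x\<close>, to the same oracle with the initial state of the
  swapped permutation, and to the run on that permutation, where the measured point is an
  independent one. With the factor 4 for squaring four terms, the two hybrid distances cost
  \<open>2 * 4 * 4 * t\<^sup>2\<close>, the blind guess costs 4, and the change of initial state is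
  the second sum.\<close>

lemma one_challenge_bound:
  assumes y: "y < N" and U: "\<And>k. k \<le> t \<Longrightarrow> unitary_mat d (U k)"
  shows "real N * (\<Sum>\<pi>\<in>perms N. \<Sum>i | i < d \<and> \<pi> (reg N R i) = y. (cmod (run d (query_mat N R G \<pi>) U (v \<pi>) t i))\<^sup>2)
    \<le> (32 * (real t)\<^sup>2 + 4) * (\<Sum>\<pi>\<in>perms N. \<Sum>i<d. (cmod (v \<pi> i))\<^sup>2)
      + 4 * (\<Sum>\<pi>\<in>perms N. \<Sum>x<N. \<Sum>i<d. (cmod (v \<pi> i - v (\<pi> \<circ> swap x (perm_inv \<pi> y)) i))\<^sup>2)"
proof -
  \<comment> \<open>\<open>D\<close> is controlled by the hybrid argument and \<open>H\<close> by
    counting over \<open>x\<close>; \<open>\<Delta>\<close> remains in the bound and is treated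
    later by low degree.\<close>
  define a where "a \<pi> s = run d (query_mat N R G \<pi>) U (v \<pi>) s" for \<pi> s
  define b where "b \<pi> x = run d (query_mat N R G (\<pi>(x := y))) U (v \<pi>) t" for \<pi> x
  define D where "D = (\<lambda>(\<pi>, x). l2 {..<d} (\<lambda>i. b \<pi> x i - a \<pi> t i))"
  define H where "H = (\<lambda>(\<pi>, x). l2 {i. i < d \<and> reg N R i = x} (a \<pi> t))"
  define \<Delta> where "\<Delta> = (\<lambda>(\<pi>, x). l2 {..<d} (\<lambda>i. v \<pi> i - v (\<pi> \<circ> swap x (perm_inv \<pi> y)) i))"
  define V where "V = (\<Sum>\<pi>\<in>perms N. (l2 {..<d} (v \<pi>))\<^sup>2)"
  let ?PX = "perms N \<times> {..<N}"
  have U': "unitary_mat d (U k)" if "k \<le> s" "s \<le> t" for k s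
    using U that by simp
  have upd: "(\<pi>(x := y)) z < N" if "\<pi> \<in> perms N" "z < N" for \<pi> x z
    using perms_value(1)[OF that(1)] y that(2) by simp
  have norm_a: "l2 {..<d} (a \<pi> s) = l2 {..<d} (v \<pi>)" if "\<pi> \<in> perms N" "s \<le> t" for \<pi> s
    unfolding a_def using perms_value(1)[OF that(1)] U'[OF _ that(2)] by (intro l2_run) auto
  have split: "(\<Sum>x<N. (l2 {i. i < d \<and> reg N R i = x} \<psi>)\<^sup>2) = (l2 {..<d} \<psi>)\<^sup>2" for \<psi>
  proof -
    have "(\<Sum>x<N. (l2 {i. i < d \<and> reg N R i = x} \<psi>)\<^sup>2) = (\<Sum>x<N. \<Sum>i\<in>{i\<in>{..<d}. reg N R i = x}. (cmod (\<psi> i))\<^sup>2)"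
      by (simp add: l2_power2)
    also have "\<dots> = (\<Sum>i<d. (cmod (\<psi> i))\<^sup>2)"
      by (rule sum.group) (auto simp: reg_less)
    finally show ?thesis by (simp add: l2_power2)
  qed
  \<comment> \<open>The run does not depend on \<open>x\<close>, so the weights at all
    \<open>x\<close> add up to the full norm: hitting an independent point is a guess.\<close>
  have sum_H: "(\<Sum>p\<in>?PX. (H p)\<^sup>2) = V"
  proof -
    have "(\<Sum>p\<in>?PX. (H p)\<^sup>2) = (\<Sum>(\<pi>, x)\<in>?PX. (l2 {i. i < d \<and> reg N R i = x} (a \<pi> t))\<^sup>2)"
      by (intro sum.cong) (auto simp: H_def)
    also have "\<dots> = (\<Sum>\<pi>\<in>perms N. (l2 {..<d} (a \<pi> t))\<^sup>2)"
      by (simp add: sum.cartesian_product[symmetric] split)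
    finally show ?thesis using norm_a by (simp add: V_def)
  qed
  \<comment> \<open>Cauchy-Schwarz over the \<open>t\<close> queries gives one factor
    \<open>t\<close>. The second appears after summing over \<open>x\<close>, when each query
    contributes the full norm.\<close>
  have "(D (\<pi>, x))\<^sup>2 \<le> 4 * real t * (\<Sum>s<t. (l2 {i. i < d \<and> reg N R i = x} (a \<pi> s))\<^sup>2)"
    if "\<pi> \<in> perms N" for \<pi> x
  proof -
    have "D (\<pi>, x) \<le> 2 * (\<Sum>s<t. l2 {i. i < d \<and> reg N R i = x} (a \<pi> s))"
      unfolding D_def a_def b_def prod.case
      using upd[OF that] perms_value(1)[OF that] U by (intro hybrid) auto
    then have "(D (\<pi>, x))\<^sup>2 \<le> (2 * (\<Sum>s<t. l2 {i. i < d \<and> reg N R i = x} (a \<pi> s)))\<^sup>2"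
      by (intro power_mono) (simp_all add: D_def)
    also have "\<dots> \<le> 4 * (real t * (\<Sum>s<t. (l2 {i. i < d \<and> reg N R i = x} (a \<pi> s))\<^sup>2))"
      using sum_squared_le_sum_of_squares[of "\<lambda>s. l2 {i. i < d \<and> reg N R i = x} (a \<pi> s)" "{..<t}"]
      by (simp add: power_mult_distrib mult.commute)
    finally show ?thesis by simp
  qed
  then have "(\<Sum>p\<in>?PX. (D p)\<^sup>2)
      \<le> (\<Sum>(\<pi>, x)\<in>?PX. 4 * real t * (\<Sum>s<t. (l2 {i. i < d \<and> reg N R i = x} (a \<pi> s))\<^sup>2))"
    by (intro sum_mono) auto
  also have "\<dots> = 4 * real t * (\<Sum>\<pi>\<in>perms N. \<Sum>s<t. \<Sum>x<N. (l2 {i. i < d \<and> reg N R i = x} (a \<pi> s))\<^sup>2)"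
    unfolding sum_distrib_left[symmetric] sum.cartesian_product[symmetric]
    by (simp only: sum.swap[of _ "{..<t}" "{..<N}"])
  also have "\<dots> = 4 * real t * (\<Sum>\<pi>\<in>perms N. \<Sum>s<t. (l2 {..<d} (v \<pi>))\<^sup>2)"
    unfolding split using norm_a by simp
  also have "\<dots> = 4 * (real t)\<^sup>2 * V"
    by (simp add: V_def power2_eq_square sum_distrib_left mult.assoc)
  finally have sum_D: "(\<Sum>p\<in>?PX. (D p)\<^sup>2) \<le> 4 * (real t)\<^sup>2 * V" .

  have reg_sets: "{i. i < d \<and> \<pi> (reg N R i) = y} = {i. i < d \<and> reg N R i = perm_inv \<pi> y}" if "\<pi> \<in> perms N" for \<pi>
    using perms_inv_eq[OF that] by metis
  have chain: "l2 {i. i < d \<and> \<pi> (reg N R i) = y} (a \<pi> t)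
      \<le> D (\<pi>, x) + \<Delta> (\<pi>, x) + H (plant_swap y (\<pi>, x)) + D (plant_swap y (\<pi>, x))"
    if \<pi>: "\<pi> \<in> perms N" and x: "x < N" for \<pi> x
  proof -
    let ?A = "{i. i < d \<and> reg N R i = perm_inv \<pi> y}" and ?\<sigma> = "\<pi> \<circ> swap x (perm_inv \<pi> y)"
    have le: "l2 ?A f \<le> l2 {..<d} f" for f
      by (rule l2_mono_set) auto
    have \<sigma>: "?\<sigma>(perm_inv \<pi> y := y) = \<pi>(x := y)"
      using perms_value(3)[OF \<pi>] by (rule fun_upd_comp_swap)
    have "l2 ?A (a \<pi> t) \<le> l2 ?A (b \<pi> x) + l2 ?A (\<lambda>i. a \<pi> t i - b \<pi> x i)"
      by (rule l2_le_add_diff)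
    also have "l2 ?A (\<lambda>i. a \<pi> t i - b \<pi> x i) \<le> D (\<pi>, x)"
      unfolding D_def prod.case by (subst l2_diff_commute) (rule le)
    also have "l2 ?A (b \<pi> x) \<le> l2 ?A (b ?\<sigma> (perm_inv \<pi> y)) + l2 ?A (\<lambda>i. b \<pi> x i - b ?\<sigma> (perm_inv \<pi> y) i)"
      by (rule l2_le_add_diff)
    \<comment> \<open>By the identity \<open>\<sigma>\<close> both planted runs use the same oracle,
      so they differ only through their initial states.\<close>
    also have "l2 ?A (\<lambda>i. b \<pi> x i - b ?\<sigma> (perm_inv \<pi> y) i) \<le> \<Delta> (\<pi>, x)"
    proof -
      have "l2 ?A (\<lambda>i. b \<pi> x i - b ?\<sigma> (perm_inv \<pi> y) i) \<le> l2 {..<d} (\<lambda>i. b \<pi> x i - b ?\<sigma> (perm_inv \<pi> y) i)"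
        by (rule le)
      also have "\<dots> = l2 {..<d} (run d (query_mat N R G (\<pi>(x := y))) U (\<lambda>i. v \<pi> i - v ?\<sigma> i) t)"
        by (simp only: b_def \<sigma> run_diff)
      also have "\<dots> = \<Delta> (\<pi>, x)"
        unfolding \<Delta>_def prod.case using upd[OF \<pi>] U by (rule l2_run)
      finally show ?thesis .
    qed
    also have "l2 ?A (b ?\<sigma> (perm_inv \<pi> y)) \<le> l2 ?A (a ?\<sigma> t) + l2 ?A (\<lambda>i. b ?\<sigma> (perm_inv \<pi> y) i - a ?\<sigma> t i)"
      by (rule l2_le_add_diff)
    \<comment> \<open>For \<open>?\<sigma>\<close>, the point \<open>perm_inv \<pi> y\<close> plays
      the part of the independent point instead of the preimage.\<close>
    also have "l2 ?A (a ?\<sigma> t) = H (plant_swap y (\<pi>, x))"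
      by (simp add: H_def plant_swap_def)
    also have "l2 ?A (\<lambda>i. b ?\<sigma> (perm_inv \<pi> y) i - a ?\<sigma> t i) \<le> D (plant_swap y (\<pi>, x))"
      by (simp add: D_def plant_swap_def le)
    finally show ?thesis unfolding reg_sets[OF \<pi>] by simp
  qed
  have "real N * (\<Sum>\<pi>\<in>perms N. (l2 {i. i < d \<and> \<pi> (reg N R i) = y} (a \<pi> t))\<^sup>2)
      = (\<Sum>(\<pi>, x)\<in>?PX. (l2 {i. i < d \<and> \<pi> (reg N R i) = y} (a \<pi> t))\<^sup>2)"
    by (simp add: sum.cartesian_product[symmetric] sum_distrib_left)
  also have "\<dots> \<le> (\<Sum>p\<in>?PX. 4 * ((D p)\<^sup>2 + (\<Delta> p)\<^sup>2 + (H (plant_swap y p))\<^sup>2 + (D (plant_swap y p))\<^sup>2))"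
  proof (rule sum_mono)
    fix p assume "p \<in> ?PX"
    then obtain \<pi> x where p: "p = (\<pi>, x)" and "\<pi> \<in> perms N" "x < N" by blast
    from chain[OF this(2,3)]
    have "(l2 {i. i < d \<and> \<pi> (reg N R i) = y} (a \<pi> t))\<^sup>2
        \<le> (D p + \<Delta> p + H (plant_swap y p) + D (plant_swap y p))\<^sup>2"
      unfolding p by (rule power_mono) simp
    also have "\<dots> \<le> 4 * ((D p)\<^sup>2 + (\<Delta> p)\<^sup>2 + (H (plant_swap y p))\<^sup>2 + (D (plant_swap y p))\<^sup>2)"
      by (rule sum4_square_le)
    finally show "(case p of (\<pi>, x) \<Rightarrow> (l2 {i. i < d \<and> \<pi> (reg N R i) = y} (a \<pi> t))\<^sup>2)
        \<le> 4 * ((D p)\<^sup>2 + (\<Delta> p)\<^sup>2 + (H (plant_swap y p))\<^sup>2 + (D (plant_swap y p))\<^sup>2)"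
      by (simp add: p)
  qed
  also have "\<dots> = 4 * ((\<Sum>p\<in>?PX. (D p)\<^sup>2) + (\<Sum>p\<in>?PX. (\<Delta> p)\<^sup>2)
      + (\<Sum>p\<in>?PX. (H (plant_swap y p))\<^sup>2) + (\<Sum>p\<in>?PX. (D (plant_swap y p))\<^sup>2))"
    unfolding sum_distrib_left[symmetric] sum.distrib ..
  also have "(\<Sum>p\<in>?PX. (H (plant_swap y p))\<^sup>2) = (\<Sum>p\<in>?PX. (H p)\<^sup>2)"
    by (rule sum.reindex_bij_betw[OF plant_swap_bij[OF y]])
  also have "(\<Sum>p\<in>?PX. (D (plant_swap y p))\<^sup>2) = (\<Sum>p\<in>?PX. (D p)\<^sup>2)"
    by (rule sum.reindex_bij_betw[OF plant_swap_bij[OF y]])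
  finally have "real N * (\<Sum>\<pi>\<in>perms N. (l2 {i. i < d \<and> \<pi> (reg N R i) = y} (a \<pi> t))\<^sup>2)
      \<le> (32 * (real t)\<^sup>2 + 4) * V + 4 * (\<Sum>p\<in>?PX. (\<Delta> p)\<^sup>2)"
    using sum_D sum_H by (simp add: algebra_simps)
  moreover have "(\<Sum>p\<in>?PX. (\<Delta> p)\<^sup>2)
      = (\<Sum>(\<pi>, x)\<in>?PX. \<Sum>i<d. (cmod (v \<pi> i - v (\<pi> \<circ> swap x (perm_inv \<pi> y)) i))\<^sup>2)"
    by (intro sum.cong) (auto simp: \<Delta>_def l2_power2)
  ultimately show ?thesis
    by (simp add: V_def a_def sum.cartesian_product[symmetric] l2_power2)
qed

text \<open>As \<open>y\<close> varies, \<open>perm_inv \<pi> y\<close> runs through all of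
  \<open>{..<N}\<close>, so the changes of initial state add up to the transposition energy of the
  amplitudes, at most \<open>8 * J * N\<close> times the squared norm. Since
  \<open>T \<ge> 1\<close>, the additive 4 of the bound for one challenge turns 32 into 36.\<close>

lemma challenge_sum_bound:
  assumes v: "\<And>i. i < d \<Longrightarrow> low_degree J (\<lambda>\<pi>. v \<pi> i)" and J: "0 < J"
    and q: "\<And>y. y < N \<Longrightarrow> q y \<le> T" and T: "0 < T"
    and U: "\<And>y k. y < N \<Longrightarrow> k \<le> q y \<Longrightarrow> unitary_mat d (U y k)"
  shows "(\<Sum>y<N. \<Sum>\<pi>\<in>perms N. \<Sum>i | i < d \<and> \<pi> (reg N R i) = y.
      (cmod (run d (query_mat N R G \<pi>) (U y) (v \<pi>) (q y) i))\<^sup>2)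
    \<le> (36 * (real T)\<^sup>2 + 32 * real J) * (\<Sum>\<pi>\<in>perms N. \<Sum>i<d. (cmod (v \<pi> i))\<^sup>2)"
proof -
  define V where "V = (\<Sum>\<pi>\<in>perms N. \<Sum>i<d. (cmod (v \<pi> i))\<^sup>2)"
  define \<Delta> where "\<Delta> y = (\<Sum>\<pi>\<in>perms N. \<Sum>x<N. \<Sum>i<d. (cmod (v \<pi> i - v (\<pi> \<circ> swap x (perm_inv \<pi> y)) i))\<^sup>2)" for y
  define X where "X y = (\<Sum>\<pi>\<in>perms N. \<Sum>i | i < d \<and> \<pi> (reg N R i) = y.
      (cmod (run d (query_mat N R G \<pi>) (U y) (v \<pi>) (q y) i))\<^sup>2)" for y
  have V0: "0 \<le> V" by (simp add: V_def sum_nonneg)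
  have each: "real N * X y \<le> 36 * (real T)\<^sup>2 * V + 4 * \<Delta> y" if "y < N" for y
  proof -
    have "real N * X y \<le> (32 * (real (q y))\<^sup>2 + 4) * V + 4 * \<Delta> y"
      unfolding X_def V_def \<Delta>_def using that U by (intro one_challenge_bound) auto
    also have "(32 * (real (q y))\<^sup>2 + 4) * V \<le> 36 * (real T)\<^sup>2 * V"
    proof (rule mult_right_mono[OF _ V0])
      have "(real (q y))\<^sup>2 \<le> (real T)\<^sup>2" using q[OF that] by (intro power_mono) auto
      moreover have "1 \<le> (real T)\<^sup>2" using T by simp
      ultimately show "32 * (real (q y))\<^sup>2 + 4 \<le> 36 * (real T)\<^sup>2" by linarith
    qed
    finally show ?thesis by simp
  qed
  have "(\<Sum>y<N. \<Delta> y) = (\<Sum>\<pi>\<in>perms N. \<Sum>y<N. \<Sum>x<N. \<Sum>i<d. (cmod (v \<pi> i - v (\<pi> \<circ> swap x (perm_inv \<pi> y)) i))\<^sup>2)"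
    unfolding \<Delta>_def by (rule sum.swap)
  also have "\<dots> = (\<Sum>\<pi>\<in>perms N. \<Sum>z<N. \<Sum>x<N. \<Sum>i<d. (cmod (v \<pi> i - v (\<pi> \<circ> swap x z) i))\<^sup>2)"
  proof (rule sum.cong[OF refl])
    fix \<pi> assume "\<pi> \<in> perms N"
    then have "bij_betw (perm_inv \<pi>) {..<N} {..<N}"
      by (intro permutes_imp_bij permutes_inv) simp
    from sum.reindex_bij_betw[OF this, of "\<lambda>z. \<Sum>x<N. \<Sum>i<d. (cmod (v \<pi> i - v (\<pi> \<circ> swap x z) i))\<^sup>2"]
    show "(\<Sum>y<N. \<Sum>x<N. \<Sum>i<d. (cmod (v \<pi> i - v (\<pi> \<circ> swap x (perm_inv \<pi> y)) i))\<^sup>2)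
      = (\<Sum>z<N. \<Sum>x<N. \<Sum>i<d. (cmod (v \<pi> i - v (\<pi> \<circ> swap x z) i))\<^sup>2)" .
  qed
  also have "\<dots> = (\<Sum>i<d. \<Sum>(z, x)\<in>{..<N} \<times> {..<N}. \<Sum>\<pi>\<in>perms N. (cmod (v \<pi> i - v (\<pi> \<circ> swap x z) i))\<^sup>2)"
    unfolding sum.cartesian_product[symmetric]
    by (simp only: sum.swap[of _ "{..<d}" "{..<N}"] sum.swap[of _ "perms N" "{..<N}"] sum.swap[of _ "{..<d}" "perms N"])
  also have "\<dots> \<le> (\<Sum>i<d. 8 * real J * real N * (\<Sum>\<pi>\<in>perms N. (cmod (v \<pi> i))\<^sup>2))"
    using transposition_energy[OF v J N_pos] by (intro sum_mono) (simp add: transpose_commute)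
  also have "\<dots> = 8 * real J * real N * V"
    unfolding V_def sum_distrib_left[symmetric] by (subst sum.swap) simp
  finally have \<Delta>: "(\<Sum>y<N. \<Delta> y) \<le> 8 * real J * real N * V" .
  have "real N * (\<Sum>y<N. X y) \<le> (\<Sum>y<N. 36 * (real T)\<^sup>2 * V + 4 * \<Delta> y)"
    unfolding sum_distrib_left using each by (intro sum_mono) auto
  also have "\<dots> = real N * (36 * (real T)\<^sup>2 * V) + 4 * (\<Sum>y<N. \<Delta> y)"
    by (simp add: sum.distrib sum_distrib_left)
  also have "\<dots> \<le> real N * ((36 * (real T)\<^sup>2 + 32 * real J) * V)"
    using \<Delta> by (simp add: algebra_simps)
  finally have "(\<Sum>y<N. X y) \<le> (36 * (real T)\<^sup>2 + 32 * real J) * V"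
    using N_pos by simp
  then show ?thesis by (simp add: X_def V_def)
qed

end

section \<open>Moments of the acceptance operator\<close>

definition trace_prod :: "nat \<Rightarrow> complex Matrix.mat \<Rightarrow> complex Matrix.mat \<Rightarrow> complex" where
  "trace_prod D \<rho> M = (\<Sum>a<D. \<Sum>b<D. \<rho> $$ (a, b) * M $$ (b, a))"

definition hermitian_mat :: "nat \<Rightarrow> complex Matrix.mat \<Rightarrow> bool" where
  "hermitian_mat D M \<longleftrightarrow> M \<in> carrier_mat D D \<and> (\<forall>a<D. \<forall>b<D. M $$ (a, b) = cnj (M $$ (b, a)))"

lemma mat_mult_index:
  assumes "A \<in> carrier_mat D D" "B \<in> carrier_mat D D" "a < D" "b < D"
  shows "(A * B) $$ (a, b) = (\<Sum>c<D. A $$ (a, c) * B $$ (c, b))"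
  using assms by (simp add: scalar_prod_def lessThan_atLeast0)

lemma hermitian_square:
  assumes "hermitian_mat D M"
  shows "hermitian_mat D (M * M)"
proof -
  have M: "M \<in> carrier_mat D D" and h: "\<And>a b. a < D \<Longrightarrow> b < D \<Longrightarrow> cnj (M $$ (a, b)) = M $$ (b, a)"
    using assms unfolding hermitian_mat_def by (blast, metis)
  have "(M * M) $$ (a, b) = cnj ((M * M) $$ (b, a))" if "a < D" "b < D" for a b
    unfolding mat_mult_index[OF M M that] mat_mult_index[OF M M that(2,1)] cnj_sum complex_cnj_mult
    using that by (intro sum.cong refl) (simp add: h)
  then show ?thesis using M unfolding hermitian_mat_def by (metis mult_carrier_mat)
qed

lemma density_form_nonneg:
  assumes "density_operator D \<rho>"
  shows "0 \<le> Re (\<Sum>a<D. \<Sum>b<D. \<rho> $$ (a, b) * v b * cnj (v a))"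
proof -
  have \<rho>: "\<rho> \<in> carrier_mat D D" using assms by (simp add: density_operator_def)
  let ?v = "Matrix.vec D v"
  have "0 \<le> (\<rho> *\<^sub>v ?v) \<bullet>c ?v"
    using assms by (simp add: density_operator_def)
  also have "(\<rho> *\<^sub>v ?v) \<bullet>c ?v = (\<Sum>a<D. \<Sum>b<D. \<rho> $$ (a, b) * v b * cnj (v a))"
    using \<rho> by (simp add: scalar_prod_def lessThan_atLeast0 sum_distrib_right)
  finally show ?thesis by (simp add: less_eq_complex_def)
qed

lemma density_trace:
  assumes "density_operator D \<rho>"
  shows "(\<Sum>a<D. \<rho> $$ (a, a)) = 1"
  using assms by (auto simp: density_operator_def mat_trace_def)

text \<open>As \<open>M\<close> is Hermitian, the trace of \<open>\<rho>\<close> against its square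
  is the sum, over the columns of \<open>M\<close>, of the quadratic form of \<open>\<rho>\<close>
  at that column.\<close>

lemma density_square_nonneg:
  assumes \<rho>: "density_operator D \<rho>" and M: "\<And>a b. a < D \<Longrightarrow> b < D \<Longrightarrow> M a b = cnj (M b a)"
  shows "0 \<le> Re (\<Sum>a<D. \<Sum>b<D. \<rho> $$ (a, b) * (\<Sum>c<D. M b c * M c a))"
proof -
  have "(\<Sum>a<D. \<Sum>b<D. \<rho> $$ (a, b) * (\<Sum>c<D. M b c * M c a))
      = (\<Sum>a<D. \<Sum>b<D. \<Sum>c<D. \<rho> $$ (a, b) * M b c * cnj (M a c))"
    unfolding sum_distrib_left
  proof (intro sum.cong refl)
    fix a b c assume "a \<in> {..<D}" "c \<in> {..<D}"
    then show "\<rho> $$ (a, b) * (M b c * M c a) = \<rho> $$ (a, b) * M b c * cnj (M a c)"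
      using M[of c a] by (simp add: mult.assoc)
  qed
  also have "\<dots> = (\<Sum>a<D. \<Sum>c<D. \<Sum>b<D. \<rho> $$ (a, b) * M b c * cnj (M a c))"
    by (rule sum.cong[OF refl sum.swap])
  also have "\<dots> = (\<Sum>c<D. \<Sum>a<D. \<Sum>b<D. \<rho> $$ (a, b) * M b c * cnj (M a c))"
    by (rule sum.swap)
  finally have eq: "(\<Sum>a<D. \<Sum>b<D. \<rho> $$ (a, b) * (\<Sum>c<D. M b c * M c a))
      = (\<Sum>c<D. \<Sum>a<D. \<Sum>b<D. \<rho> $$ (a, b) * M b c * cnj (M a c))" .
  show ?thesis
    by (subst eq, subst Re_sum, rule sum_nonneg, rule density_form_nonneg[OF \<rho>])
qed

text \<open>Expand the nonnegative trace of \<open>\<rho>\<close> against the square of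
  \<open>F - t\<close>, using that \<open>\<rho>\<close> has trace 1. For fixed \<open>t\<close> the
  bound is linear in the trace product, so it can be averaged over many \<open>\<rho>\<close> with a
  common \<open>t\<close>.\<close>

lemma trace_prod_square_ge:
  assumes \<rho>: "density_operator D \<rho>" and F: "hermitian_mat D F"
  shows "2 * t * Re (trace_prod D \<rho> F) - t\<^sup>2 \<le> Re (trace_prod D \<rho> (F * F))"
proof -
  have Fc: "F \<in> carrier_mat D D" and Fh: "\<And>a b. a < D \<Longrightarrow> b < D \<Longrightarrow> F $$ (a, b) = cnj (F $$ (b, a))"
    using F unfolding hermitian_mat_def by blast+
  define M where "M a b = F $$ (a, b) - (if a = b then complex_of_real t else 0)" for a b
  have MM: "(\<Sum>c<D. M b c * M c a)
      = (F * F) $$ (b, a) - 2 * of_real t * F $$ (b, a) + (if a = b then (of_real t)\<^sup>2 else 0)"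
    if "a < D" "b < D" for a b
  proof -
    have "(\<Sum>c<D. M b c * M c a) = (\<Sum>c<D. F $$ (b, c) * F $$ (c, a)
        - (if c = b then of_real t * F $$ (c, a) else 0) - (if c = a then of_real t * F $$ (b, c) else 0)
        + (if c = b then (if a = b then (of_real t)\<^sup>2 else 0) else 0))"
      by (intro sum.cong refl) (auto simp: M_def algebra_simps power2_eq_square)
    also have "\<dots> = (\<Sum>c<D. F $$ (b, c) * F $$ (c, a)) - of_real t * F $$ (b, a) - of_real t * F $$ (b, a)
        + (if a = b then (of_real t)\<^sup>2 else 0)"
      using that by (simp add: sum.distrib sum_subtractf)
    finally show ?thesis
      using that by (simp add: mat_mult_index[OF Fc Fc] del: index_mult_mat)
  qed
  have diag: "(\<Sum>b<D. \<rho> $$ (a, b) * (if a = b then (of_real t)\<^sup>2 else 0)) = \<rho> $$ (a, a) * (of_real t)\<^sup>2"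
    if "a < D" for a
    using that by (simp add: if_distrib cong: if_cong)
  have "0 \<le> Re (\<Sum>a<D. \<Sum>b<D. \<rho> $$ (a, b) * (\<Sum>c<D. M b c * M c a))"
  proof (rule density_square_nonneg[OF \<rho>])
    fix a b assume "a < D" "b < D"
    then show "M a b = cnj (M b a)"
      unfolding M_def by (subst Fh) auto
  qed
  also have "(\<Sum>a<D. \<Sum>b<D. \<rho> $$ (a, b) * (\<Sum>c<D. M b c * M c a))
      = (\<Sum>a<D. \<Sum>b<D. \<rho> $$ (a, b) * (F * F) $$ (b, a) - 2 * of_real t * (\<rho> $$ (a, b) * F $$ (b, a))
          + \<rho> $$ (a, b) * (if a = b then (of_real t)\<^sup>2 else 0))"
    by (intro sum.cong refl) (simp add: MM algebra_simps del: index_mult_mat)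
  also have "\<dots> = trace_prod D \<rho> (F * F) - 2 * of_real t * trace_prod D \<rho> F
      + (\<Sum>a<D. \<Sum>b<D. \<rho> $$ (a, b) * (if a = b then (of_real t)\<^sup>2 else 0))"
    unfolding trace_prod_def sum.distrib sum_subtractf sum_distrib_left by simp
  also have "(\<Sum>a<D. \<Sum>b<D. \<rho> $$ (a, b) * (if a = b then (of_real t)\<^sup>2 else 0))
      = (\<Sum>a<D. \<rho> $$ (a, a)) * (of_real t)\<^sup>2"
    unfolding sum_distrib_right by (intro sum.cong refl diag) simp
  also have "\<dots> = (of_real t)\<^sup>2"
    by (simp add: density_trace[OF \<rho>])
  finally show ?thesis by (simp flip: of_real_power)
qed

lemma complex_unit_align: "\<exists>u. cmod u = 1 \<and> z * u = complex_of_real (- cmod z)"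
proof (cases "z = 0")
  case True
  then show ?thesis by (intro exI[of _ 1]) simp
next
  case False
  then show ?thesis
    by (intro exI[of _ "- cnj z / complex_of_real (cmod z)"])
      (simp add: norm_divide complex_norm_square[symmetric] power2_eq_square)
qed

text \<open>Off the diagonal, positivity is applied to a vector supported on \<open>i\<close> and
  \<open>j\<close>, with a phase \<open>u\<close> that makes both cross terms equal to
  \<open>- cmod (\<rho> $$ (i, j))\<close>. Twice the modulus of the entry is then at most the sum
  of two diagonal entries, hence at most the trace.\<close>

lemma density_entry_le_1:
  assumes \<rho>: "density_operator D \<rho>" and i: "i < D" and j: "j < D"
  shows "cmod (\<rho> $$ (i, j)) \<le> 1"
proof -
  have herm: "\<rho> $$ (a, b) = cnj (\<rho> $$ (b, a))" if "a < D" "b < D" for a b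
    using \<rho> mat_adjoint_index[of \<rho> D D a b] that by (simp add: density_operator_def)
  have form: "0 \<le> Re (\<Sum>a\<in>A. \<Sum>b\<in>A. \<rho> $$ (a, b) * v b * cnj (v a))"
    if "A \<subseteq> {..<D}" "\<And>a. a \<notin> A \<Longrightarrow> v a = 0" for A v
  proof -
    have "(\<Sum>a<D. \<Sum>b<D. \<rho> $$ (a, b) * v b * cnj (v a)) = (\<Sum>a\<in>A. \<Sum>b<D. \<rho> $$ (a, b) * v b * cnj (v a))"
      using that by (intro sum.mono_neutral_right) auto
    also have "\<dots> = (\<Sum>a\<in>A. \<Sum>b\<in>A. \<rho> $$ (a, b) * v b * cnj (v a))"
      using that by (intro sum.cong refl sum.mono_neutral_right) auto
    finally show ?thesis using density_form_nonneg[OF \<rho>, of v] by simp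
  qed
  have diag: "0 \<le> Re (\<rho> $$ (a, a))" if "a < D" for a
    using form[of "{a}" "\<lambda>c. if c = a then 1 else 0"] that by simp
  have tr: "(\<Sum>a<D. Re (\<rho> $$ (a, a))) = 1"
    using arg_cong[OF density_trace[OF \<rho>], of Re] by simp
  show ?thesis
  proof (cases "i = j")
    case True
    have "Re (\<rho> $$ (i, i)) \<le> (\<Sum>a<D. Re (\<rho> $$ (a, a)))"
      using i diag by (intro member_le_sum) auto
    moreover have "Im (\<rho> $$ (i, i)) = 0"
      using arg_cong[OF herm[OF i i], of Im] by simp
    ultimately show ?thesis
      using True tr diag[OF i] by (simp add: cmod_def)
  next
    case False
    obtain u where u: "cmod u = 1" "\<rho> $$ (i, j) * u = complex_of_real (- cmod (\<rho> $$ (i, j)))"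
      using complex_unit_align by blast
    have "0 \<le> Re (\<rho> $$ (i, i)) + Re (\<rho> $$ (j, j)) - 2 * cmod (\<rho> $$ (i, j))"
    proof -
      define v where "v a = (if a = i then 1 else if a = j then u else 0)" for a
      have uu: "u * cnj u = 1" using u(1) complex_norm_square[of u] by simp
      have "\<rho> $$ (j, i) * cnj u = cnj (\<rho> $$ (i, j) * u)"
        using herm[OF j i] by simp
      then have ji: "\<rho> $$ (j, i) * cnj u = complex_of_real (- cmod (\<rho> $$ (i, j)))"
        by (simp only: u(2) complex_cnj_complex_of_real)
      have "(\<Sum>a\<in>{i, j}. \<Sum>b\<in>{i, j}. \<rho> $$ (a, b) * v b * cnj (v a))
          = \<rho> $$ (i, i) + \<rho> $$ (i, j) * u + (\<rho> $$ (j, i) * cnj u + \<rho> $$ (j, j) * (u * cnj u))"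
        using False by (simp add: v_def)
      then show ?thesis
        using form[of "{i, j}" v] i j unfolding u(2) ji uu by (simp add: v_def)
    qed
    also have "Re (\<rho> $$ (i, i)) + Re (\<rho> $$ (j, j)) = (\<Sum>a\<in>{i, j}. Re (\<rho> $$ (a, a)))"
      using False by simp
    also have "(\<Sum>a\<in>{i, j}. Re (\<rho> $$ (a, a))) \<le> (\<Sum>a<D. Re (\<rho> $$ (a, a)))"
      using i j diag by (intro sum_mono2) auto
    finally show ?thesis using tr by simp
  qed
qed

text \<open>The power of \<open>E\<close> with exponent \<open>2 ^ j\<close>: the moment inequality
  used later doubles the exponent at each step.\<close>

primrec square_iter :: "complex Matrix.mat \<Rightarrow> nat \<Rightarrow> complex Matrix.mat" where
  "square_iter E 0 = E"
| "square_iter E (Suc j) = square_iter E j * square_iter E j"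

lemma hermitian_square_iter: "hermitian_mat D E \<Longrightarrow> hermitian_mat D (square_iter E j)"
  by (induction j) (simp_all add: hermitian_square)

lemma apply_mat_funpow_cong:
  "(\<And>a. a < D \<Longrightarrow> \<psi> a = \<phi> a) \<Longrightarrow> a < D \<Longrightarrow> (apply_mat D E ^^ m) \<psi> a = (apply_mat D E ^^ m) \<phi> a"
  by (induction m arbitrary: a) (auto intro: apply_mat_cong)

lemma apply_square_iter:
  assumes "E \<in> carrier_mat D D" "a < D"
  shows "apply_mat D (square_iter E j) \<psi> a = (apply_mat D E ^^ (2 ^ j)) \<psi> a"
  using assms(2)
proof (induction j arbitrary: \<psi> a)
  case (Suc j)
  have c: "square_iter E j \<in> carrier_mat D D"
    using assms(1) by (induction j) auto
  have "apply_mat D (square_iter E (Suc j)) \<psi> a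
      = (apply_mat D E ^^ (2 ^ j)) (apply_mat D (square_iter E j) \<psi>) a"
    using Suc apply_mat_mult[OF c c] by simp
  also have "\<dots> = (apply_mat D E ^^ (2 ^ j)) ((apply_mat D E ^^ (2 ^ j)) \<psi>) a"
    using Suc by (intro apply_mat_funpow_cong) auto
  also have "\<dots> = (apply_mat D E ^^ (2 ^ Suc j)) \<psi> a"
    by (simp add: mult_2 funpow_add)
  finally show ?case .
qed simp

text \<open>Columns of the power are iterates on basis vectors, which reduces its Frobenius norm to
  the growth of vectors under \<open>E\<close>.\<close>

lemma square_iter_index:
  assumes "E \<in> carrier_mat D D" "a < D" "b < D"
  shows "square_iter E j $$ (a, b) = (apply_mat D E ^^ (2 ^ j)) (\<lambda>c. if c = b then 1 else 0) a"
proof -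
  have "apply_mat D (square_iter E j) (\<lambda>c. if c = b then 1 else 0) a = square_iter E j $$ (a, b)"
    using assms(3) by (simp add: apply_mat_def if_distrib cong: if_cong)
  then show ?thesis using apply_square_iter[OF assms(1,2)] by simp
qed

text \<open>\<open>\<psi>\<close> is the Gram operator of \<open>w\<close> applied to
  \<open>\<phi>\<close>, so its squared norm is the inner product of \<open>w \<psi>\<close> with
  \<open>w \<phi>\<close>. Cauchy-Schwarz then uses the bound \<open>\<delta>\<close> at these two
  families only, which is what makes the lemma applicable when \<open>\<delta>\<close> is known just
  for low degree.\<close>

lemma gram_norm_bound:
  fixes w :: "'p \<Rightarrow> 'z \<Rightarrow> nat \<Rightarrow> complex" and \<phi> :: "'p \<Rightarrow> nat \<Rightarrow> complex"
    and P :: "'p set" and Z :: "'z set" and D :: nat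
  defines "\<psi> \<equiv> \<lambda>\<pi> a. \<Sum>z\<in>Z. cnj (w \<pi> z a) * (\<Sum>b<D. w \<pi> z b * \<phi> \<pi> b)"
  assumes b1: "(\<Sum>\<pi>\<in>P. \<Sum>z\<in>Z. (cmod (\<Sum>b<D. w \<pi> z b * \<phi> \<pi> b))\<^sup>2)
      \<le> \<delta> * (\<Sum>\<pi>\<in>P. \<Sum>b<D. (cmod (\<phi> \<pi> b))\<^sup>2)"
    and b2: "(\<Sum>\<pi>\<in>P. \<Sum>z\<in>Z. (cmod (\<Sum>b<D. w \<pi> z b * \<psi> \<pi> b))\<^sup>2)
      \<le> \<delta> * (\<Sum>\<pi>\<in>P. \<Sum>b<D. (cmod (\<psi> \<pi> b))\<^sup>2)"
    and \<delta>: "0 \<le> \<delta>"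
  shows "(\<Sum>\<pi>\<in>P. \<Sum>a<D. (cmod (\<psi> \<pi> a))\<^sup>2) \<le> \<delta>\<^sup>2 * (\<Sum>\<pi>\<in>P. \<Sum>a<D. (cmod (\<phi> \<pi> a))\<^sup>2)"
proof -
  define X where "X = (\<Sum>\<pi>\<in>P. \<Sum>a<D. (cmod (\<psi> \<pi> a))\<^sup>2)"
  define Y where "Y = (\<Sum>\<pi>\<in>P. \<Sum>a<D. (cmod (\<phi> \<pi> a))\<^sup>2)"
  define g where "g = (\<lambda>(\<pi>, z). \<Sum>b<D. w \<pi> z b * \<phi> \<pi> b)"
  define h where "h = (\<lambda>(\<pi>, z). \<Sum>a<D. w \<pi> z a * \<psi> \<pi> a)"
  have nonneg: "0 \<le> X" "0 \<le> Y" by (simp_all add: X_def Y_def sum_nonneg)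
  have g: "(l2 (P \<times> Z) g)\<^sup>2 \<le> \<delta> * Y" and h: "(l2 (P \<times> Z) h)\<^sup>2 \<le> \<delta> * X"
    using b1 b2 by (simp_all add: l2_power2 g_def h_def X_def Y_def sum.cartesian_product' case_prod_unfold)
  have "complex_of_real X = (\<Sum>\<pi>\<in>P. \<Sum>a<D. \<Sum>z\<in>Z. cnj (\<psi> \<pi> a) * (cnj (w \<pi> z a) * g (\<pi>, z)))"
    unfolding X_def of_real_sum sum_distrib_left[symmetric]
    by (intro sum.cong refl) (simp add: complex_norm_square mult.commute \<psi>_def g_def del: of_real_power)
  also have "\<dots> = (\<Sum>\<pi>\<in>P. \<Sum>z\<in>Z. cnj (h (\<pi>, z)) * g (\<pi>, z))"
  proof (intro sum.cong refl)
    fix \<pi>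
    have "(\<Sum>a<D. \<Sum>z\<in>Z. cnj (\<psi> \<pi> a) * (cnj (w \<pi> z a) * g (\<pi>, z)))
        = (\<Sum>z\<in>Z. \<Sum>a<D. cnj (\<psi> \<pi> a) * (cnj (w \<pi> z a) * g (\<pi>, z)))"
      by (rule sum.swap)
    also have "\<dots> = (\<Sum>z\<in>Z. cnj (h (\<pi>, z)) * g (\<pi>, z))"
      unfolding h_def prod.case cnj_sum complex_cnj_mult sum_distrib_right
      by (intro sum.cong refl) (simp add: mult_ac)
    finally show "(\<Sum>a<D. \<Sum>z\<in>Z. cnj (\<psi> \<pi> a) * (cnj (w \<pi> z a) * g (\<pi>, z)))
        = (\<Sum>z\<in>Z. cnj (h (\<pi>, z)) * g (\<pi>, z))" .
  qed
  also have "\<dots> = (\<Sum>p\<in>P \<times> Z. cnj (h p) * g p)"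
    by (simp add: sum.cartesian_product')
  finally have "X = cmod (\<Sum>p\<in>P \<times> Z. cnj (h p) * g p)"
    using nonneg(1) by (metis abs_of_nonneg norm_of_real)
  also have "\<dots> \<le> l2 (P \<times> Z) h * l2 (P \<times> Z) g"
    using l2_Cauchy_Schwarz[of "\<lambda>p. cnj (h p)" g "P \<times> Z"] by simp
  finally have "X\<^sup>2 \<le> (l2 (P \<times> Z) h * l2 (P \<times> Z) g)\<^sup>2"
    using nonneg(1) by (intro power_mono) auto
  also have "\<dots> \<le> (\<delta> * X) * (\<delta> * Y)"
    unfolding power_mult_distrib using g h nonneg \<delta> by (intro mult_mono) auto
  finally have "X * X \<le> X * (\<delta>\<^sup>2 * Y)"
    by (simp add: power2_eq_square mult_ac)
  then have "X \<le> \<delta>\<^sup>2 * Y"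
    using nonneg by (cases "X = 0") auto
  then show ?thesis by (simp add: X_def Y_def)
qed

lemma power_of_two_between:
  assumes "0 < (S::nat)"
  shows "\<exists>m. S \<le> 2 ^ m \<and> 2 ^ m \<le> 2 * S"
proof -
  have ex: "S \<le> 2 ^ S" by (simp add: less_imp_le)
  define m where "m = (LEAST m. S \<le> 2 ^ m)"
  have m: "S \<le> 2 ^ m" unfolding m_def using ex by (rule LeastI)
  have "2 ^ m \<le> 2 * S"
  proof (cases m)
    case (Suc k)
    have "\<not> S \<le> 2 ^ k" using not_less_Least[of k "\<lambda>m. S \<le> 2 ^ m"] Suc by (simp add: m_def)
    then show ?thesis using Suc by simp
  qed (use assms in simp)
  with m show ?thesis by blast
qed

text \<open>The advice disappears from the bound at the cost of the factor \<open>D\<^sup>2\<close>, which is harmless after taking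
  a root of order at least \<open>S = log 2 D\<close>.\<close>

lemma advice_moment_bound:
  fixes \<rho> E :: "'p \<Rightarrow> complex Matrix.mat"
  assumes P: "finite P" "P \<noteq> {}"
    and \<rho>: "\<And>\<pi>. \<pi> \<in> P \<Longrightarrow> density_operator D (\<rho> \<pi>)"
    and E: "\<And>\<pi>. \<pi> \<in> P \<Longrightarrow> hermitian_mat D (E \<pi>)"
    and F: "(\<Sum>\<pi>\<in>P. \<Sum>a<D. \<Sum>b<D. (cmod (square_iter (E \<pi>) m $$ (a, b)))\<^sup>2)
      \<le> real (card P) * real D * B\<^sup>2" and B: "0 \<le> B"
    and pos: "0 \<le> (\<Sum>\<pi>\<in>P. Re (trace_prod D (\<rho> \<pi>) (E \<pi>))) / card P"
  shows "((\<Sum>\<pi>\<in>P. Re (trace_prod D (\<rho> \<pi>) (E \<pi>))) / card P) ^ (2 ^ m) \<le> (real D)\<^sup>2 * B"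
proof -
  define n where "n = real (card P)"
  have n: "0 < n" using P by (simp add: n_def card_gt_0_iff)
  define c where "c j = (\<Sum>\<pi>\<in>P. Re (trace_prod D (\<rho> \<pi>) (square_iter (E \<pi>) j))) / n" for j
  \<comment> \<open>Jensen's inequality for the average over \<open>P\<close>: the common
    \<open>t\<close> in \<open>trace_prod_square_ge\<close> is the average \<open>c j\<close>
    itself.\<close>
  have c_step: "(c j)\<^sup>2 \<le> c (Suc j)" for j
  proof -
    have "(\<Sum>\<pi>\<in>P. 2 * c j * Re (trace_prod D (\<rho> \<pi>) (square_iter (E \<pi>) j)) - (c j)\<^sup>2)
        \<le> (\<Sum>\<pi>\<in>P. Re (trace_prod D (\<rho> \<pi>) (square_iter (E \<pi>) (Suc j))))"
      using trace_prod_square_ge[OF \<rho> hermitian_square_iter[OF E]] by (intro sum_mono) auto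
    also have "(\<Sum>\<pi>\<in>P. 2 * c j * Re (trace_prod D (\<rho> \<pi>) (square_iter (E \<pi>) j)) - (c j)\<^sup>2)
        = 2 * c j * (n * c j) - n * (c j)\<^sup>2"
    proof -
      have "(\<Sum>\<pi>\<in>P. Re (trace_prod D (\<rho> \<pi>) (square_iter (E \<pi>) j))) = n * c j"
        using n by (simp add: c_def)
      then show ?thesis
        by (simp add: sum_subtractf sum_distrib_left[symmetric] n_def)
    qed
    also have "\<dots> = n * (c j)\<^sup>2" by (simp add: power2_eq_square)
    finally show ?thesis using n by (simp add: c_def[of "Suc j"] field_simps)
  qed
  have c_pow: "(c 0) ^ (2 ^ j) \<le> c j" for j
  proof (induction j)
    case (Suc j)
    have "(c 0) ^ (2 ^ Suc j) = ((c 0) ^ (2 ^ j))\<^sup>2"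
      by (simp add: power_mult[symmetric] mult.commute)
    also have "\<dots> \<le> (c j)\<^sup>2"
      using Suc pos by (intro power_mono) (simp_all add: c_def n_def)
    also have "\<dots> \<le> c (Suc j)" by (rule c_step)
    finally show ?case .
  qed simp
  define I where "I = P \<times> ({..<D} \<times> {..<D})"
  let ?f = "\<lambda>(\<pi>, a, b). cmod (square_iter (E \<pi>) m $$ (a, b))"
  \<comment> \<open>Entries of a density operator have modulus at most 1, so bounding the trace
    product entrywise removes the advice.\<close>
  have "n * c m \<le> (\<Sum>\<pi>\<in>P. \<Sum>a<D. \<Sum>b<D. cmod (square_iter (E \<pi>) m $$ (b, a)))"
  proof -
    have "Re (trace_prod D (\<rho> \<pi>) M) \<le> (\<Sum>a<D. \<Sum>b<D. cmod (M $$ (b, a)))" if "\<pi> \<in> P" for \<pi> M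
    proof -
      have "Re (trace_prod D (\<rho> \<pi>) M) \<le> (\<Sum>a<D. \<Sum>b<D. cmod (\<rho> \<pi> $$ (a, b) * M $$ (b, a)))"
        unfolding trace_prod_def Re_sum by (intro sum_mono complex_Re_le_cmod)
      also have "\<dots> \<le> (\<Sum>a<D. \<Sum>b<D. cmod (M $$ (b, a)))"
        using density_entry_le_1[OF \<rho>[OF that]]
        by (intro sum_mono) (simp add: norm_mult mult_left_le_one_le)
      finally show ?thesis .
    qed
    then show ?thesis using n by (simp add: c_def sum_mono)
  qed
  also have "\<dots> = (\<Sum>p\<in>I. ?f p)"
    by (subst sum.swap[of _ "{..<D}"]) (simp add: I_def sum.cartesian_product')
  \<comment> \<open>Cauchy-Schwarz over the \<open>card P * D * D\<close> entries passes to the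
    Frobenius norms that the hypothesis bounds.\<close>
  also have "\<dots> \<le> sqrt (\<Sum>p\<in>I. (1::real)) * sqrt (\<Sum>p\<in>I. (?f p)\<^sup>2)"
    using L2_set_mult_ineq[of "\<lambda>_. 1" ?f I] by (simp add: L2_set_def case_prod_unfold)
  also have "\<dots> \<le> sqrt (n * real D * real D) * sqrt (n * real D * B\<^sup>2)"
  proof (intro mult_mono real_sqrt_le_mono)
    show "(\<Sum>p\<in>I. (1::real)) \<le> n * real D * real D"
      by (simp add: I_def n_def card_cartesian_product)
    show "(\<Sum>p\<in>I. (?f p)\<^sup>2) \<le> n * real D * B\<^sup>2"
      using F by (simp add: I_def n_def sum.cartesian_product' case_prod_unfold)
  qed (simp_all add: n_def sum_nonneg)
  also have "sqrt (n * real D * real D) * sqrt (n * real D * B\<^sup>2) = n * (real D * sqrt (real D) * B)"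
  proof -
    have "sqrt (n * real D * real D) = sqrt n * real D" "sqrt (n * real D * B\<^sup>2) = sqrt n * sqrt (real D) * B"
      using B by (simp_all add: real_sqrt_mult mult.assoc)
    moreover have "sqrt n * sqrt n = n" using n by simp
    ultimately show ?thesis by (simp add: algebra_simps)
  qed
  finally have "n * c m \<le> n * (real D * sqrt (real D) * B)" .
  then have "c m \<le> real D * sqrt (real D) * B"
    using n by simp
  also have "\<dots> \<le> real D * real D * B"
  proof -
    have "sqrt (real D) \<le> real D"
      by (cases "D = 0") (auto intro!: real_le_lsqrt simp: power2_eq_square)
    then show ?thesis using B by (intro mult_right_mono mult_left_mono) auto
  qed
  finally have "c m \<le> (real D)\<^sup>2 * B" by (simp add: power2_eq_square)
  then show ?thesis
    using c_pow[of m] by (simp add: c_def n_def)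
qed

section \<open>From the experiment to matrix entries\<close>

lemma expectation_pair_uniform:
  fixes f :: "'a \<times> 'b \<Rightarrow> real"
  assumes "finite A" "A \<noteq> {}" "finite B" "B \<noteq> {}"
  shows "measure_pmf.expectation (pair_pmf (pmf_of_set A) (pmf_of_set B)) f
    = (\<Sum>a\<in>A. \<Sum>b\<in>B. f (a, b)) / (real (card A) * real (card B))"
proof -
  have "pair_pmf (pmf_of_set A) (pmf_of_set B) = pmf_of_set (A \<times> B)"
    using assms by (intro pmf_eqI) (simp add: split_paired_all pmf_pair card_cartesian_product indicator_times)
  then show ?thesis
    using assms by (simp add: integral_pmf_of_set card_cartesian_product sum.cartesian_product')
qed

text \<open>An advice vector as a state of all registers. The ancilla is the least significant digit
  and everything but the advice starts at 0, so advice index \<open>a\<close> sits at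
  \<open>a * anc\<close>.\<close>

definition embed :: "nat \<Rightarrow> nat \<Rightarrow> (nat \<Rightarrow> complex) \<Rightarrow> nat \<Rightarrow> complex" where
  "embed D anc \<phi> i = (if i < D * anc \<and> anc dvd i then \<phi> (i div anc) else 0)"

lemma sum_multiples:
  fixes h :: "nat \<Rightarrow> 'a::comm_monoid_add"
  assumes "0 < anc" "D * anc \<le> n"
  shows "(\<Sum>i<n. if i < D * anc \<and> anc dvd i then h i else 0) = (\<Sum>a<D. h (a * anc))"
proof -
  have img: "{i \<in> {..<n}. i < D * anc \<and> anc dvd i} = (\<lambda>a. a * anc) ` {..<D}"
    using assms by (auto simp: dvd_def mult.commute intro: less_le_trans[OF mult_strict_right_mono])
  have "(\<Sum>i<n. if i < D * anc \<and> anc dvd i then h i else 0) = (\<Sum>i | i \<in> {..<n} \<and> i < D * anc \<and> anc dvd i. h i)"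
    by (intro sum.mono_neutral_cong_right) auto
  also have "\<dots> = (\<Sum>a<D. h (a * anc))"
    using img assms(1) by (simp add: sum.reindex inj_on_def)
  finally show ?thesis .
qed

lemma apply_embed:
  assumes "0 < anc" "D * anc \<le> n"
  shows "apply_mat n M (embed D anc \<phi>) i = (\<Sum>a<D. M $$ (i, a * anc) * \<phi> a)"
  unfolding apply_mat_def embed_def
  using sum_multiples[OF assms, of "\<lambda>j. M $$ (i, j) * \<phi> (j div anc)"] assms(1)
  by (simp add: if_distrib cong: if_cong)

lemma norm_embed:
  assumes "0 < anc" "D * anc \<le> n"
  shows "(\<Sum>i<n. (cmod (embed D anc \<phi> i))\<^sup>2) = (\<Sum>a<D. (cmod (\<phi> a))\<^sup>2)"
proof -
  have "(\<Sum>i<n. (cmod (embed D anc \<phi> i))\<^sup>2)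
      = (\<Sum>i<n. if i < D * anc \<and> anc dvd i then (cmod (\<phi> (i div anc)))\<^sup>2 else 0)"
    by (intro sum.cong) (auto simp: embed_def)
  then show ?thesis
    using assms(1) by (simp add: sum_multiples[OF assms])
qed

lemma kron_index:
  "i < dim_row A * dim_row B \<Longrightarrow> j < dim_col A * dim_col B \<Longrightarrow>
    kron A B $$ (i, j) = A $$ (i div dim_row B, j div dim_col B) * B $$ (i mod dim_row B, j mod dim_col B)"
  by (simp add: kron_def)

lemma kron_dims [simp]:
  "dim_row (kron A B) = dim_row A * dim_row B" "dim_col (kron A B) = dim_col A * dim_col B"
  by (simp_all add: kron_def)

lemma basis_proj_dims [simp]: "dim_row (basis_proj n i) = n" "dim_col (basis_proj n i) = n"
  by (simp_all add: basis_proj_def)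

lemma basis_proj_index:
  "r < n \<Longrightarrow> c < n \<Longrightarrow> basis_proj n i $$ (r, c) = (if r = i \<and> c = i then 1 else 0)"
  by (simp add: basis_proj_def)

context query_setup
begin

lemma measurement_index:
  assumes "i < d" "k < d"
  shows "kron (1\<^sub>m 2) (kron (basis_proj N x) (1\<^sub>m (N * R))) $$ (i, k)
    = (if i = k \<and> reg N R i = x then 1 else 0)"
proof -
  let ?m = "N * R"
  have m: "0 < ?m" "0 < N * ?m" using N_pos R_pos by auto
  have lt: "j div (N * ?m) < 2" "(j mod (N * ?m)) div ?m < N" "(j mod (N * ?m)) mod ?m < ?m"
    "j mod (N * ?m) < N * ?m" if "j < d" for j
    using that m by (auto simp: qdim_def mult.assoc intro!: div_less_mult)
  have r: "(j mod (N * ?m)) div ?m = reg N R j" for j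
    unfolding reg_def mult.commute[of N ?m] mod_mult2_eq[of j ?m N] using m by simp
  have eq: "i = k \<longleftrightarrow> i div (N * ?m) = k div (N * ?m) \<and> reg N R i = reg N R k
      \<and> (i mod (N * ?m)) mod ?m = (k mod (N * ?m)) mod ?m"
    unfolding r[symmetric] using div_mod_eqI by blast
  have dd: "d = 2 * (N * ?m)" by (simp add: qdim_def mult.assoc)
  have "kron (1\<^sub>m 2) (kron (basis_proj N x) (1\<^sub>m ?m)) $$ (i, k)
      = (1\<^sub>m 2) $$ (i div (N * ?m), k div (N * ?m))
        * (basis_proj N x $$ (reg N R i, reg N R k) * (1\<^sub>m ?m) $$ ((i mod (N * ?m)) mod ?m, (k mod (N * ?m)) mod ?m))"
    using assms lt[OF assms(1)] lt[OF assms(2)] by (simp add: kron_index dd r)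
  also have "\<dots> = (if i = k \<and> reg N R i = x then 1 else 0)"
    unfolding eq using lt[OF assms(1)] lt[OF assms(2)] by (auto simp: basis_proj_index reg_less)
  finally show ?thesis .
qed

lemma initial_index:
  assumes R: "R = D * anc" and anc: "0 < anc" and \<rho>: "\<rho> \<in> carrier_mat D D" and kl: "k < d" "l < d"
  shows "kron (basis_proj (2 * (N * N)) 0) (kron \<rho> (basis_proj anc 0)) $$ (k, l)
    = (if (k < R \<and> anc dvd k) \<and> (l < R \<and> anc dvd l) then \<rho> $$ (k div anc, l div anc) else 0)"
proof -
  have lt: "j div R < 2 * (N * N)" "(j mod R) div anc < D" "(j mod R) mod anc < anc" "j mod R < R" if "j < d" for j
    using that R_pos anc by (auto simp: R qdim_def intro!: div_less_mult)
  have zz: "(j div R = 0 \<and> (j mod R) mod anc = 0) = (j < R \<and> anc dvd j)" for j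
    using R_pos by (cases "j < R") (auto simp: div_eq_0_iff)
  have "kron (basis_proj (2 * (N * N)) 0) (kron \<rho> (basis_proj anc 0)) $$ (k, l)
      = basis_proj (2 * (N * N)) 0 $$ (k div R, l div R)
        * (\<rho> $$ ((k mod R) div anc, (l mod R) div anc) * basis_proj anc 0 $$ ((k mod R) mod anc, (l mod R) mod anc))"
    using kl lt[OF kl(1)] lt[OF kl(2)] \<rho> by (simp add: kron_index qdim_def R)
  also have "\<dots> = (if (k div R = 0 \<and> (k mod R) mod anc = 0) \<and> (l div R = 0 \<and> (l mod R) mod anc = 0)
      then \<rho> $$ ((k mod R) div anc, (l mod R) div anc) else 0)"
    using lt[OF kl(1)] lt[OF kl(2)] by (simp only: basis_proj_index) simp
  also have "\<dots> = (if (k < R \<and> anc dvd k) \<and> (l < R \<and> anc dvd l) then \<rho> $$ (k div anc, l div anc) else 0)"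
    unfolding zz by simp
  finally show ?thesis .
qed

text \<open>The Born rule in coordinates: the initial state lives on the indices
  \<open>a * anc\<close>, so only those columns of \<open>V\<close> enter, and the diagonal output
  projector selects the rows.\<close>

lemma final_trace:
  assumes R: "R = D * anc" and anc: "0 < anc" and \<rho>: "\<rho> \<in> carrier_mat D D" and V: "V \<in> carrier_mat d d"
  shows "mat_trace (kron (1\<^sub>m 2) (kron (basis_proj N x) (1\<^sub>m (N * R))) *
      (V * kron (basis_proj (2 * (N * N)) 0) (kron \<rho> (basis_proj anc 0)) * mat_adjoint V))
    = (\<Sum>i | i < d \<and> reg N R i = x. \<Sum>a<D. \<Sum>b<D. \<rho> $$ (a, b) * (cnj (V $$ (i, b * anc)) * V $$ (i, a * anc)))"
proof -
  define K where "K = kron (basis_proj (2 * (N * N)) 0) (kron \<rho> (basis_proj anc 0))"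
  define M where "M = kron (1\<^sub>m 2) (kron (basis_proj N x) (1\<^sub>m (N * R)))"
  have le: "D * anc \<le> d" using N_pos by (simp add: qdim_def R)
  have K: "K \<in> carrier_mat d d"
    unfolding K_def using \<rho> by (intro carrier_matI) (simp_all add: qdim_def R)
  have M: "M \<in> carrier_mat d d"
    unfolding M_def by (intro carrier_matI) (simp_all add: qdim_def)
  have VK: "V * K \<in> carrier_mat d d" using V K by simp
  have Va: "mat_adjoint V \<in> carrier_mat d d" by (rule mat_adjoint_carrier[OF V])
  have X: "V * K * mat_adjoint V \<in> carrier_mat d d" using VK Va by simp
  have entry: "(V * K * mat_adjoint V) $$ (i, i)
      = (\<Sum>a<D. \<Sum>b<D. \<rho> $$ (a, b) * (cnj (V $$ (i, b * anc)) * V $$ (i, a * anc)))" if i: "i < d" for i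
  proof -
    have "(V * K * mat_adjoint V) $$ (i, i) = (\<Sum>l<d. (\<Sum>k<d. V $$ (i, k) * K $$ (k, l)) * cnj (V $$ (i, l)))"
      unfolding mat_mult_index[OF VK Va i i]
      using i by (intro sum.cong refl) (simp add: mat_mult_index[OF V K] mat_adjoint_index[OF V] del: index_mult_mat)
    also have "\<dots> = (\<Sum>l<d. if l < D * anc \<and> anc dvd l then
        (\<Sum>k<d. if k < D * anc \<and> anc dvd k then V $$ (i, k) * \<rho> $$ (k div anc, l div anc) else 0) * cnj (V $$ (i, l)) else 0)"
    proof (intro sum.cong refl)
      fix l assume "l \<in> {..<d}"
      then have l: "l < d" by simp
      have "(\<Sum>k<d. V $$ (i, k) * K $$ (k, l)) = (if l < D * anc \<and> anc dvd l then
          (\<Sum>k<d. if k < D * anc \<and> anc dvd k then V $$ (i, k) * \<rho> $$ (k div anc, l div anc) else 0) else 0)"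
        unfolding K_def
        by (cases "l < D * anc \<and> anc dvd l")
          (auto simp: initial_index[OF R anc \<rho> _ l] R intro!: sum.cong sum.neutral)
      then show "(\<Sum>k<d. V $$ (i, k) * K $$ (k, l)) * cnj (V $$ (i, l)) = (if l < D * anc \<and> anc dvd l then
        (\<Sum>k<d. if k < D * anc \<and> anc dvd k then V $$ (i, k) * \<rho> $$ (k div anc, l div anc) else 0) * cnj (V $$ (i, l)) else 0)"
        by simp
    qed
    also have "\<dots> = (\<Sum>b<D. (\<Sum>a<D. V $$ (i, a * anc) * \<rho> $$ (a, b)) * cnj (V $$ (i, b * anc)))"
      using anc by (simp add: sum_multiples[OF anc le])
    also have "\<dots> = (\<Sum>b<D. \<Sum>a<D. \<rho> $$ (a, b) * (cnj (V $$ (i, b * anc)) * V $$ (i, a * anc)))"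
      unfolding sum_distrib_right by (intro sum.cong refl) (simp add: mult_ac)
    also have "\<dots> = (\<Sum>a<D. \<Sum>b<D. \<rho> $$ (a, b) * (cnj (V $$ (i, b * anc)) * V $$ (i, a * anc)))"
      by (rule sum.swap)
    finally show ?thesis .
  qed
  have "(M * (V * K * mat_adjoint V)) $$ (i, i)
      = (if reg N R i = x then (V * K * mat_adjoint V) $$ (i, i) else 0)" if i: "i < d" for i
  proof -
    have "(M * (V * K * mat_adjoint V)) $$ (i, i) = (\<Sum>k<d. M $$ (i, k) * (V * K * mat_adjoint V) $$ (k, i))"
      by (rule mat_mult_index[OF M X i i])
    also have "\<dots> = (\<Sum>k<d. if k = i then (if reg N R i = x then (V * K * mat_adjoint V) $$ (i, i) else 0) else 0)"
      using i by (intro sum.cong refl) (auto simp: M_def measurement_index simp del: index_mult_mat)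
    finally show ?thesis using i by simp
  qed
  then have "mat_trace (M * (V * K * mat_adjoint V))
      = (\<Sum>i<d. if reg N R i = x then (V * K * mat_adjoint V) $$ (i, i) else 0)"
    using M X by (auto simp: mat_trace_def simp del: index_mult_mat(1) intro!: sum.cong)
  also have "\<dots> = (\<Sum>i | i < d \<and> reg N R i = x. (V * K * mat_adjoint V) $$ (i, i))"
    by (intro sum.mono_neutral_cong_right) auto
  also have "\<dots> = (\<Sum>i | i < d \<and> reg N R i = x. \<Sum>a<D. \<Sum>b<D. \<rho> $$ (a, b) * (cnj (V $$ (i, b * anc)) * V $$ (i, a * anc)))"
    using entry by (intro sum.cong) auto
  finally show ?thesis by (simp add: K_def M_def)
qed

text \<open>The polynomial method: gates are constant in \<open>\<pi>\<close>, and each query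
  multiplies by a matrix whose entries depend on one value of \<open>\<pi>\<close>.\<close>

lemma low_degree_circuit:
  assumes "\<And>k. k \<le> t \<Longrightarrow> U k \<in> carrier_mat d d" "i < d" "j < d"
  shows "low_degree t (\<lambda>\<pi>. circuit (query_mat N R G \<pi>) U t $$ (i, j))"
  using assms
proof (induction t arbitrary: i)
  case 0
  then show ?case by (simp add: low_degree_const)
next
  case (Suc t)
  have c: "circuit (query_mat N R G \<pi>) U t \<in> carrier_mat d d" for \<pi>
    using Suc.prems by (intro circuit_carrier query_mat_carrier) auto
  have U: "U (Suc t) \<in> carrier_mat d d" using Suc.prems by simp
  have q: "low_degree 1 (\<lambda>\<pi>. query_mat N R G \<pi> $$ (k, l))" if "k < d" "l < d" for k l
    by (rule low_degree.junta[of "{reg N R l}"]) (auto simp: determined_by_def intro!: query_mat_cong that)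
  have "low_degree (Suc t) (\<lambda>\<pi>. \<Sum>k<d. U (Suc t) $$ (i, k)
      * (\<Sum>l<d. query_mat N R G \<pi> $$ (k, l) * circuit (query_mat N R G \<pi>) U t $$ (l, j)))"
  proof (intro low_degree_sum)
    fix k assume "k \<in> {..<d}"
    then have "low_degree (1 + t) (\<lambda>\<pi>. \<Sum>l<d. query_mat N R G \<pi> $$ (k, l) * circuit (query_mat N R G \<pi>) U t $$ (l, j))"
      using Suc by (intro low_degree_sum low_degree_mult q) auto
    then show "low_degree (Suc t) (\<lambda>\<pi>. U (Suc t) $$ (i, k)
        * (\<Sum>l<d. query_mat N R G \<pi> $$ (k, l) * circuit (query_mat N R G \<pi>) U t $$ (l, j)))"
      using low_degree_mult[OF low_degree_const[of 0 "U (Suc t) $$ (i, k)"]] by simp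
  qed
  also have "(\<lambda>\<pi>. \<Sum>k<d. U (Suc t) $$ (i, k)
      * (\<Sum>l<d. query_mat N R G \<pi> $$ (k, l) * circuit (query_mat N R G \<pi>) U t $$ (l, j)))
      = (\<lambda>\<pi>. circuit (query_mat N R G \<pi>) U (Suc t) $$ (i, j))"
  proof
    fix \<pi>
    have qc: "query_mat N R G \<pi> * circuit (query_mat N R G \<pi>) U t \<in> carrier_mat d d"
      using query_mat_carrier c by (rule mult_carrier_mat)
    show "(\<Sum>k<d. U (Suc t) $$ (i, k)
      * (\<Sum>l<d. query_mat N R G \<pi> $$ (k, l) * circuit (query_mat N R G \<pi>) U t $$ (l, j)))
      = circuit (query_mat N R G \<pi>) U (Suc t) $$ (i, j)"
      unfolding circuit.simps mat_mult_index[OF U qc Suc.prems(2,3)]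
      using Suc.prems(3) by (intro sum.cong refl) (simp add: mat_mult_index[OF query_mat_carrier c] del: index_mult_mat)
  qed
  finally show ?case .
qed

end

section \<open>The inversion bound\<close>

locale aux_attack = query_setup N "2 ^ S * ancilla_dim A" G
  for N S :: nat and G :: "nat monoid" and A :: aux_algorithm +
  fixes T :: nat
  assumes S_pos: "0 < S" and T_pos: "0 < T" and alg: "is_aux_algorithm N S T A"
begin

abbreviation D :: nat where "D \<equiv> 2 ^ S"
abbreviation anc :: nat where "anc \<equiv> ancilla_dim A"
abbreviation R :: nat where "R \<equiv> D * anc"

definition V :: "(nat \<Rightarrow> nat) \<Rightarrow> nat \<Rightarrow> complex Matrix.mat" where
  "V \<pi> y = circuit (query_mat N R G \<pi>) (gate A y) (queries A y)"

text \<open>\<open>w \<pi>\<close> maps an advice vector to its accepting final amplitudes over all challenges, so \<open>E \<pi>\<close> is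
  \<open>N\<close> times the acceptance operator of the average challenge.\<close>

definition w :: "(nat \<Rightarrow> nat) \<Rightarrow> nat \<times> nat \<Rightarrow> nat \<Rightarrow> complex" where
  "w \<pi> = (\<lambda>(y, i) a. if \<pi> (reg N R i) = y then V \<pi> y $$ (i, a * anc) else 0)"

definition E :: "(nat \<Rightarrow> nat) \<Rightarrow> complex Matrix.mat" where
  "E \<pi> = Matrix.mat D D (\<lambda>(a, b). \<Sum>z\<in>{..<N} \<times> {..<d}. cnj (w \<pi> z a) * w \<pi> z b)"

lemma total_dim_eq: "total_dim N S A = d"
  by (simp add: total_dim_def qdim_def)

lemma anc_pos: "0 < anc"
  using alg by (simp add: is_aux_algorithm_def)

lemma anc_le: "D * anc \<le> d"
  using N_pos by (simp add: qdim_def)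

lemma queries_le: "y < N \<Longrightarrow> queries A y \<le> T"
  using alg by (simp add: is_aux_algorithm_def)

lemma gate_unitary: "y < N \<Longrightarrow> k \<le> queries A y \<Longrightarrow> unitary_mat d (gate A y k)"
  using alg by (simp add: is_aux_algorithm_def total_dim_eq)

lemma gate_carrier: "y < N \<Longrightarrow> k \<le> queries A y \<Longrightarrow> gate A y k \<in> carrier_mat d d"
  using gate_unitary by (simp add: unitary_mat_def)

lemma advice_density: "\<pi> \<in> perms N \<Longrightarrow> density_operator D (advice A \<pi>)"
  using alg by (simp add: is_aux_algorithm_def)

lemma V_carrier: "y < N \<Longrightarrow> V \<pi> y \<in> carrier_mat d d"
  unfolding V_def by (intro circuit_carrier query_mat_carrier gate_carrier)

lemma column_less: "a < D \<Longrightarrow> a * anc < d"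
  using mult_strict_right_mono[of a D anc] anc_pos anc_le by linarith

section \<open>Degree and norm growth of the acceptance operator\<close>

lemma E_index: "a < D \<Longrightarrow> b < D \<Longrightarrow> E \<pi> $$ (a, b) = (\<Sum>z\<in>{..<N} \<times> {..<d}. cnj (w \<pi> z a) * w \<pi> z b)"
  by (simp add: E_def)

lemma E_hermitian: "hermitian_mat D (E \<pi>)"
  unfolding hermitian_mat_def
proof (intro conjI allI impI)
  show "E \<pi> \<in> carrier_mat D D" by (simp add: E_def)
  show "E \<pi> $$ (a, b) = cnj (E \<pi> $$ (b, a))" if "a < D" "b < D" for a b
    unfolding E_index[OF that] E_index[OF that(2,1)] cnj_sum
    by (intro sum.cong refl) (simp add: mult.commute)
qed

text \<open>The queries contribute \<open>T\<close>, and testing whether the output is mapped to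
  \<open>y\<close> contributes one more.\<close>

lemma low_degree_w:
  assumes "z \<in> {..<N} \<times> {..<d}" "a < D"
  shows "low_degree (T + 1) (\<lambda>\<pi>. w \<pi> z a)"
proof -
  obtain y i where z: "z = (y, i)" "y < N" "i < d" using assms(1) by auto
  have "low_degree (queries A y) (\<lambda>\<pi>. V \<pi> y $$ (i, a * anc))"
    unfolding V_def using z assms(2) gate_carrier column_less by (intro low_degree_circuit) auto
  then have "low_degree T (\<lambda>\<pi>. V \<pi> y $$ (i, a * anc))"
    using queries_le[OF z(2)] by (rule low_degree_mono)
  then have "low_degree (1 + T) (\<lambda>\<pi>. (if \<pi> (reg N R i) = y then 1 else 0) * V \<pi> y $$ (i, a * anc))"
    by (intro low_degree_mult low_degree_value[of "\<lambda>v. if v = y then 1 else 0"])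
  also have "(\<lambda>\<pi>. (if \<pi> (reg N R i) = y then 1 else 0) * V \<pi> y $$ (i, a * anc)) = (\<lambda>\<pi>. w \<pi> z a)"
    by (simp add: w_def z fun_eq_iff)
  finally show ?thesis by (simp add: add.commute)
qed

lemma low_degree_E:
  assumes "a < D" "b < D"
  shows "low_degree (2 * T + 2) (\<lambda>\<pi>. E \<pi> $$ (a, b))"
proof -
  have "low_degree ((T + 1) + (T + 1)) (\<lambda>\<pi>. \<Sum>z\<in>{..<N} \<times> {..<d}. cnj (w \<pi> z a) * w \<pi> z b)"
    using assms by (intro low_degree_sum low_degree_mult low_degree_cnj low_degree_w)
  then show ?thesis by (simp add: E_index[OF assms] mult_2)
qed

lemma low_degree_apply_E:
  assumes "\<And>b. b < D \<Longrightarrow> low_degree J (\<lambda>\<pi>. \<phi> \<pi> b)" "a < D"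
  shows "low_degree (2 * T + 2 + J) (\<lambda>\<pi>. apply_mat D (E \<pi>) (\<phi> \<pi>) a)"
  unfolding apply_mat_def using assms
  by (intro low_degree_sum low_degree_mult low_degree_E) auto

text \<open>Each application of \<open>E\<close> adds the degree of its entries; the start vector is
  constant in \<open>\<pi>\<close>.\<close>

lemma low_degree_E_funpow:
  assumes "a < D"
  shows "low_degree (m * (2 * T + 2)) (\<lambda>\<pi>. (apply_mat D (E \<pi>) ^^ m) \<phi> a)"
  using assms
proof (induction m arbitrary: a)
  case 0
  then show ?case by (simp add: low_degree_const)
next
  case (Suc m)
  have "low_degree (2 * T + 2 + m * (2 * T + 2)) (\<lambda>\<pi>. apply_mat D (E \<pi>) ((apply_mat D (E \<pi>) ^^ m) \<phi>) a)"
    using Suc by (intro low_degree_apply_E)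
  moreover have "2 * T + 2 + m * (2 * T + 2) = Suc m * (2 * T + 2)" by simp
  ultimately show ?case by (simp only: funpow.simps comp_apply)
qed

text \<open>\<open>w \<pi>\<close> sends an advice vector to the accepting part of the runs started
  from its embedding, so the bound for low-degree initial states applies. The vector
  \<open>\<phi> \<pi>\<close> may itself vary with \<open>\<pi>\<close>, as iterates of
  \<open>E\<close> do.\<close>

lemma w_sum_bound:
  assumes \<phi>: "\<And>b. b < D \<Longrightarrow> low_degree J (\<lambda>\<pi>. \<phi> \<pi> b)" and J: "0 < J"
  shows "(\<Sum>\<pi>\<in>perms N. \<Sum>z\<in>{..<N} \<times> {..<d}. (cmod (\<Sum>b<D. w \<pi> z b * \<phi> \<pi> b))\<^sup>2)
    \<le> (36 * (real T)\<^sup>2 + 32 * real J) * (\<Sum>\<pi>\<in>perms N. \<Sum>b<D. (cmod (\<phi> \<pi> b))\<^sup>2)"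
proof -
  let ?v = "\<lambda>\<pi>. embed D anc (\<phi> \<pi>)"
  let ?r = "\<lambda>\<pi> y. run d (query_mat N R G \<pi>) (gate A y) (?v \<pi>) (queries A y)"
  have w: "(\<Sum>b<D. w \<pi> (y, i) b * \<phi> \<pi> b) = (if \<pi> (reg N R i) = y then ?r \<pi> y i else 0)"
    if "y < N" "i < d" for \<pi> y i
    using apply_circuit[of "query_mat N R G \<pi>" d "queries A y" "gate A y" i "?v \<pi>"]
      query_mat_carrier gate_carrier[OF that(1)] that
    by (simp add: w_def V_def apply_embed[OF anc_pos anc_le])
  have "(\<Sum>\<pi>\<in>perms N. \<Sum>z\<in>{..<N} \<times> {..<d}. (cmod (\<Sum>b<D. w \<pi> z b * \<phi> \<pi> b))\<^sup>2)
      = (\<Sum>\<pi>\<in>perms N. \<Sum>y<N. \<Sum>i | i < d \<and> \<pi> (reg N R i) = y. (cmod (?r \<pi> y i))\<^sup>2)"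
    unfolding sum.cartesian_product'
    by (intro sum.cong refl sum.mono_neutral_cong_right) (auto simp: w)
  also have "\<dots> = (\<Sum>y<N. \<Sum>\<pi>\<in>perms N. \<Sum>i | i < d \<and> \<pi> (reg N R i) = y. (cmod (?r \<pi> y i))\<^sup>2)"
    by (rule sum.swap)
  also have "\<dots> \<le> (36 * (real T)\<^sup>2 + 32 * real J) * (\<Sum>\<pi>\<in>perms N. \<Sum>i<d. (cmod (?v \<pi> i))\<^sup>2)"
  proof (rule challenge_sum_bound[OF _ J queries_le T_pos gate_unitary])
    show "low_degree J (\<lambda>\<pi>. ?v \<pi> i)" for i
    proof (cases "i < D * anc \<and> anc dvd i")
      case True
      then have "i div anc < D" by (simp add: less_mult_imp_div_less)
      then show ?thesis using \<phi> True by (simp add: embed_def)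
    next
      case False
      then have "embed D anc \<psi> i = 0" for \<psi> by (auto simp: embed_def)
      then show ?thesis by (simp add: low_degree_const)
    qed
  qed
  also have "(\<Sum>\<pi>\<in>perms N. \<Sum>i<d. (cmod (?v \<pi> i))\<^sup>2) = (\<Sum>\<pi>\<in>perms N. \<Sum>b<D. (cmod (\<phi> \<pi> b))\<^sup>2)"
    by (simp add: norm_embed[OF anc_pos anc_le])
  finally show ?thesis .
qed

text \<open>The Gram bound is used at \<open>\<phi>\<close> and at its image under \<open>E\<close>,
  so \<open>J'\<close> has to accommodate the additional degree \<open>2 * T + 2\<close>.\<close>

lemma E_norm_bound:
  assumes \<phi>: "\<And>b. b < D \<Longrightarrow> low_degree J (\<lambda>\<pi>. \<phi> \<pi> b)" and J: "2 * T + 2 + J \<le> J'"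
  shows "(\<Sum>\<pi>\<in>perms N. \<Sum>a<D. (cmod (apply_mat D (E \<pi>) (\<phi> \<pi>) a))\<^sup>2)
    \<le> (36 * (real T)\<^sup>2 + 32 * real J')\<^sup>2 * (\<Sum>\<pi>\<in>perms N. \<Sum>a<D. (cmod (\<phi> \<pi> a))\<^sup>2)"
proof -
  let ?\<psi> = "\<lambda>\<pi> a. \<Sum>z\<in>{..<N} \<times> {..<d}. cnj (w \<pi> z a) * (\<Sum>b<D. w \<pi> z b * \<phi> \<pi> b)"
  have \<psi>: "apply_mat D (E \<pi>) (\<phi> \<pi>) a = ?\<psi> \<pi> a" if "a < D" for \<pi> a
  proof -
    have "apply_mat D (E \<pi>) (\<phi> \<pi>) a = (\<Sum>b<D. \<Sum>z\<in>{..<N} \<times> {..<d}. cnj (w \<pi> z a) * w \<pi> z b * \<phi> \<pi> b)"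
      unfolding apply_mat_def using that by (intro sum.cong refl) (simp add: E_index sum_distrib_right)
    also have "\<dots> = ?\<psi> \<pi> a"
      unfolding sum_distrib_left by (subst sum.swap) (simp add: mult.assoc)
    finally show ?thesis .
  qed
  have J': "0 < J'" using J by simp
  have "(\<Sum>\<pi>\<in>perms N. \<Sum>a<D. (cmod (?\<psi> \<pi> a))\<^sup>2)
    \<le> (36 * (real T)\<^sup>2 + 32 * real J')\<^sup>2 * (\<Sum>\<pi>\<in>perms N. \<Sum>a<D. (cmod (\<phi> \<pi> a))\<^sup>2)"
  proof (rule gram_norm_bound)
    show "(\<Sum>\<pi>\<in>perms N. \<Sum>z\<in>{..<N} \<times> {..<d}. (cmod (\<Sum>b<D. w \<pi> z b * \<phi> \<pi> b))\<^sup>2)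
      \<le> (36 * (real T)\<^sup>2 + 32 * real J') * (\<Sum>\<pi>\<in>perms N. \<Sum>b<D. (cmod (\<phi> \<pi> b))\<^sup>2)"
      using J by (intro w_sum_bound[OF low_degree_mono[OF \<phi>] J']) auto
    have "low_degree J' (\<lambda>\<pi>. ?\<psi> \<pi> b)" if "b < D" for b
      using low_degree_mono[OF low_degree_apply_E[of J \<phi>, OF \<phi> that] J] by (simp add: \<psi>[OF that])
    then show "(\<Sum>\<pi>\<in>perms N. \<Sum>z\<in>{..<N} \<times> {..<d}. (cmod (\<Sum>b<D. w \<pi> z b * ?\<psi> \<pi> b))\<^sup>2)
      \<le> (36 * (real T)\<^sup>2 + 32 * real J') * (\<Sum>\<pi>\<in>perms N. \<Sum>b<D. (cmod (?\<psi> \<pi> b))\<^sup>2)"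
      by (rule w_sum_bound[OF _ J'])
  qed simp
  then show ?thesis by (simp add: \<psi>)
qed

text \<open>One \<open>J'\<close> covers the degrees of all iterates, so every application costs the
  same factor.\<close>

lemma E_funpow_norm_bound:
  assumes "m * (2 * T + 2) \<le> J'"
  shows "(\<Sum>\<pi>\<in>perms N. \<Sum>a<D. (cmod ((apply_mat D (E \<pi>) ^^ m) \<phi> a))\<^sup>2)
    \<le> ((36 * (real T)\<^sup>2 + 32 * real J') ^ m)\<^sup>2 * (real (card (perms N)) * (\<Sum>a<D. (cmod (\<phi> a))\<^sup>2))"
  using assms
proof (induction m)
  case (Suc m)
  let ?\<delta> = "36 * (real T)\<^sup>2 + 32 * real J'"
  have "(\<Sum>\<pi>\<in>perms N. \<Sum>a<D. (cmod ((apply_mat D (E \<pi>) ^^ Suc m) \<phi> a))\<^sup>2)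
      \<le> ?\<delta>\<^sup>2 * (\<Sum>\<pi>\<in>perms N. \<Sum>a<D. (cmod ((apply_mat D (E \<pi>) ^^ m) \<phi> a))\<^sup>2)"
    using E_norm_bound[of "m * (2 * T + 2)" "\<lambda>\<pi>. (apply_mat D (E \<pi>) ^^ m) \<phi>" J', OF low_degree_E_funpow]
      Suc.prems by simp
  also have "\<dots> \<le> ?\<delta>\<^sup>2 * ((?\<delta> ^ m)\<^sup>2 * (real (card (perms N)) * (\<Sum>a<D. (cmod (\<phi> a))\<^sup>2)))"
    using Suc by (intro mult_left_mono) auto
  finally show ?case by (simp add: power_mult_distrib mult.assoc)
qed simp

text \<open>Grouping the basis indices by their output turns the sum over preimages of
  \<open>y\<close> into a sum over accepting indices; summed over \<open>y\<close>, this pairs the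
  advice with the Gram matrix \<open>E\<close>.\<close>

lemma success_prob_eq:
  "success_prob N S G A = (\<Sum>\<pi>\<in>perms N. Re (trace_prod D (advice A \<pi>) (E \<pi>))) / card (perms N) / N"
proof -
  have y: "(\<Sum>x | x < N \<and> \<pi> x = y. output_prob N S G A \<pi> y x)
      = Re (\<Sum>a<D. \<Sum>b<D. advice A \<pi> $$ (a, b) * (\<Sum>i<d. cnj (w \<pi> (y, i) b) * w \<pi> (y, i) a))"
    if \<pi>: "\<pi> \<in> perms N" and "y < N" for \<pi> y
  proof -
    have \<rho>: "advice A \<pi> \<in> carrier_mat D D"
      using advice_density[OF \<pi>] by (simp add: density_operator_def)
    define h where "h i = (\<Sum>a<D. \<Sum>b<D. advice A \<pi> $$ (a, b) * (cnj (V \<pi> y $$ (i, b * anc)) * V \<pi> y $$ (i, a * anc)))" for i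
    have "output_prob N S G A \<pi> y x = Re (\<Sum>i | i < d \<and> reg N R i = x. h i)" for x
      unfolding output_prob_def final_state_def Let_def initial_state_def query_mat_def[symmetric]
        V_def[symmetric] h_def final_trace[OF refl anc_pos \<rho> V_carrier[OF \<open>y < N\<close>]] ..
    moreover have "{i. i < d \<and> reg N R i = x} = {i \<in> {i. i < d \<and> \<pi> (reg N R i) = y}. reg N R i = x}"
      if "\<pi> x = y" for x using that by auto
    ultimately have "(\<Sum>x | x < N \<and> \<pi> x = y. output_prob N S G A \<pi> y x)
        = Re (\<Sum>x\<in>{x. x < N \<and> \<pi> x = y}. \<Sum>i\<in>{i \<in> {i. i < d \<and> \<pi> (reg N R i) = y}. reg N R i = x}. h i)"
      by (subst Re_sum, intro sum.cong refl) simp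
    also have "(\<Sum>x\<in>{x. x < N \<and> \<pi> x = y}. \<Sum>i\<in>{i \<in> {i. i < d \<and> \<pi> (reg N R i) = y}. reg N R i = x}. h i)
        = (\<Sum>i\<in>{i. i < d \<and> \<pi> (reg N R i) = y}. h i)"
      by (rule sum.group) (auto simp: reg_less)
    also have "\<dots> = (\<Sum>i<d. \<Sum>a<D. \<Sum>b<D. advice A \<pi> $$ (a, b) * (cnj (w \<pi> (y, i) b) * w \<pi> (y, i) a))"
      by (rule sum.mono_neutral_cong_left) (auto simp: h_def w_def)
    also have "\<dots> = (\<Sum>a<D. \<Sum>b<D. advice A \<pi> $$ (a, b) * (\<Sum>i<d. cnj (w \<pi> (y, i) b) * w \<pi> (y, i) a))"
      unfolding sum_distrib_left by (rule trans[OF sum.swap sum.cong[OF refl sum.swap]])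
    finally show ?thesis .
  qed
  have \<pi>: "(\<Sum>y<N. \<Sum>x | x < N \<and> \<pi> x = y. output_prob N S G A \<pi> y x) = Re (trace_prod D (advice A \<pi>) (E \<pi>))"
    if "\<pi> \<in> perms N" for \<pi>
  proof -
    have "(\<Sum>y<N. \<Sum>x | x < N \<and> \<pi> x = y. output_prob N S G A \<pi> y x)
        = Re (\<Sum>y<N. \<Sum>a<D. \<Sum>b<D. advice A \<pi> $$ (a, b) * (\<Sum>i<d. cnj (w \<pi> (y, i) b) * w \<pi> (y, i) a))"
      by (subst Re_sum, intro sum.cong refl y[OF that]) simp
    also have "(\<Sum>y<N. \<Sum>a<D. \<Sum>b<D. advice A \<pi> $$ (a, b) * (\<Sum>i<d. cnj (w \<pi> (y, i) b) * w \<pi> (y, i) a))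
        = (\<Sum>a<D. \<Sum>b<D. \<Sum>y<N. advice A \<pi> $$ (a, b) * (\<Sum>i<d. cnj (w \<pi> (y, i) b) * w \<pi> (y, i) a))"
      by (rule trans[OF sum.swap sum.cong[OF refl sum.swap]])
    also have "\<dots> = trace_prod D (advice A \<pi>) (E \<pi>)"
      unfolding trace_prod_def
      by (intro sum.cong refl) (simp add: E_index sum_distrib_left[symmetric] sum.cartesian_product')
    finally show ?thesis .
  qed
  have "perms N \<noteq> {}" using permutes_id by blast
  then have "success_prob N S G A = (\<Sum>\<pi>\<in>perms N. \<Sum>y<N. \<Sum>x | x < N \<and> \<pi> x = y. output_prob N S G A \<pi> y x)
      / (real (card (perms N)) * real N)"
    unfolding success_prob_def using N_pos
    by (subst expectation_pair_uniform) auto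
  also have "(\<Sum>\<pi>\<in>perms N. \<Sum>y<N. \<Sum>x | x < N \<and> \<pi> x = y. output_prob N S G A \<pi> y x)
      = (\<Sum>\<pi>\<in>perms N. Re (trace_prod D (advice A \<pi>) (E \<pi>)))"
    by (rule sum.cong[OF refl \<pi>])
  finally show ?thesis by simp
qed

text \<open>The exponent \<open>k\<close> is a power of two between \<open>S\<close> and
  \<open>2 * S\<close>: large enough that the \<open>k\<close>-th root of the advice factor
  \<open>4 ^ S\<close> is at most 4, and small enough that the degree \<open>J\<close> of the
  iterates stays of order \<open>S * T\<close>.\<close>

lemma success_prob_bound:
  "success_prob N S G A \<le> 1024 * (real S * real T / real N + (real T)\<^sup>2 / real N)"
proof -
  let ?a = "(\<Sum>\<pi>\<in>perms N. Re (trace_prod D (advice A \<pi>) (E \<pi>))) / card (perms N)"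
  obtain m where m: "S \<le> 2 ^ m" "2 ^ m \<le> 2 * S"
    using power_of_two_between[OF S_pos] by blast
  define k where "k = (2::nat) ^ m"
  define J where "J = k * (2 * T + 2)"
  define \<delta> where "\<delta> = 36 * (real T)\<^sup>2 + 32 * real J"
  have \<delta>0: "0 \<le> \<delta>" by (simp add: \<delta>_def)
  have "?a \<le> 4 * \<delta>"
  proof (cases "0 \<le> ?a")
    case True
    have frob: "(\<Sum>\<pi>\<in>perms N. \<Sum>a<D. \<Sum>b<D. (cmod (square_iter (E \<pi>) m $$ (a, b)))\<^sup>2)
        \<le> real (card (perms N)) * real D * (\<delta> ^ k)\<^sup>2"
    proof -
      have Ec: "E \<pi> \<in> carrier_mat D D" for \<pi> by (simp add: E_def)
      let ?e = "\<lambda>b c. if c = b then 1 else 0 :: complex"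
      have "(\<Sum>\<pi>\<in>perms N. \<Sum>a<D. \<Sum>b<D. (cmod (square_iter (E \<pi>) m $$ (a, b)))\<^sup>2)
          = (\<Sum>\<pi>\<in>perms N. \<Sum>b<D. \<Sum>a<D. (cmod ((apply_mat D (E \<pi>) ^^ k) (?e b) a))\<^sup>2)"
        unfolding k_def by (rule sum.cong[OF refl trans[OF sum.swap]])
          (intro sum.cong refl, simp add: square_iter_index[OF Ec])
      also have "\<dots> = (\<Sum>b<D. \<Sum>\<pi>\<in>perms N. \<Sum>a<D. (cmod ((apply_mat D (E \<pi>) ^^ k) (?e b) a))\<^sup>2)"
        by (rule sum.swap)
      also have "\<dots> \<le> (\<Sum>b<D. (\<delta> ^ k)\<^sup>2 * (real (card (perms N)) * (\<Sum>a<D. (cmod (?e b a))\<^sup>2)))"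
        unfolding \<delta>_def by (intro sum_mono E_funpow_norm_bound) (simp add: J_def)
      also have "\<dots> = (\<Sum>b<D. (\<delta> ^ k)\<^sup>2 * real (card (perms N)))"
      proof (intro sum.cong refl)
        fix b assume "b \<in> {..<D}"
        moreover have "(\<Sum>a<D. (cmod (?e b a))\<^sup>2) = (\<Sum>a<D. if a = b then 1 else 0)"
          by (intro sum.cong refl) simp
        ultimately have "(\<Sum>a<D. (cmod (?e b a))\<^sup>2) = 1" by simp
        then show "(\<delta> ^ k)\<^sup>2 * (real (card (perms N)) * (\<Sum>a<D. (cmod (?e b a))\<^sup>2)) = (\<delta> ^ k)\<^sup>2 * real (card (perms N))"
          by simp
      qed
      finally show ?thesis by (simp add: mult_ac)
    qed
    have "?a ^ k \<le> (real D)\<^sup>2 * \<delta> ^ k"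
      unfolding k_def
    proof (rule advice_moment_bound)
      show "perms N \<noteq> {}" using permutes_id by blast
    qed (use frob \<delta>0 True in \<open>auto simp: k_def intro: advice_density E_hermitian\<close>)
    also have "(real D)\<^sup>2 = 4 ^ S"
      by (simp add: power2_eq_square power_mult_distrib[symmetric])
    also have "(4::real) ^ S * \<delta> ^ k \<le> 4 ^ k * \<delta> ^ k"
      using m(1) \<delta>0 by (intro mult_right_mono power_increasing) (auto simp: k_def)
    also have "\<dots> = (4 * \<delta>) ^ k" by (simp add: power_mult_distrib)
    \<comment> \<open>\<open>power_le_imp_le_base\<close> takes roots of successor exponents, hence
      \<open>k - 1\<close>; as a power of two, \<open>k\<close> is positive.\<close>
    finally show ?thesis
      using power_le_imp_le_base[of ?a "k - 1" "4 * \<delta>"] \<delta>0 by (simp add: k_def)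
  next
    case False
    then show ?thesis using \<delta>0 by linarith
  qed
  also have "\<dots> \<le> 1024 * (real S * real T + (real T)\<^sup>2)"
  proof -
    \<comment> \<open>\<open>T \<ge> 1\<close> gives \<open>2 * T + 2 \<le> 4 * T\<close>.\<close>
    have "J \<le> (2 * S) * (4 * T)"
      unfolding J_def using m(2) T_pos by (intro mult_mono) (auto simp: k_def)
    then have "real J \<le> real ((2 * S) * (4 * T))"
      by (rule of_nat_mono)
    then have J8: "real J \<le> 8 * (real S * real T)"
      by simp
    \<comment> \<open>The constant is \<open>4 * 32 * 8\<close>, set by the term with
      \<open>S * T\<close>; the term with \<open>T\<^sup>2\<close> needs
      \<open>4 * 36\<close>.\<close>
    have linear: "4 * (36 * t + 32 * j) \<le> 1024 * (s + t)" if "j \<le> 8 * s" "0 \<le> t" for s t j :: real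
      using that by simp
    show ?thesis
      unfolding \<delta>_def by (rule linear[OF J8]) simp
  qed
  finally have "?a \<le> 1024 * (real S * real T + (real T)\<^sup>2)" .
  then have "?a / real N \<le> 1024 * (real S * real T + (real T)\<^sup>2) / real N"
    by (intro divide_right_mono) simp_all
  then show ?thesis
    unfolding success_prob_eq by (simp add: add_divide_distrib)
qed

end

theorem theorem1:
  shows "\<exists>C::real. C > 0 \<and>
    (\<forall>(N::nat) (S::nat) (T::nat) (G::nat monoid) (A::aux_algorithm).
       0 < N \<longrightarrow> 0 < S \<longrightarrow> 0 < T \<longrightarrow>
       group G \<longrightarrow> carrier G = {..<N} \<longrightarrow>
       is_aux_algorithm N S T A \<longrightarrow>
       success_prob N S G A \<le> C * (real S * real T / real N + (real T)\<^sup>2 / real N))"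
proof (intro exI[of _ 1024] conjI allI impI)
  fix N S T :: nat and G :: "nat monoid" and A :: aux_algorithm
  assume "0 < N" "0 < S" "0 < T" "group G" "carrier G = {..<N}" "is_aux_algorithm N S T A"
  then interpret aux_attack N S G A T
    by (intro aux_attack.intro query_setup.intro aux_attack_axioms.intro) (auto simp: is_aux_algorithm_def)
  show "success_prob N S G A \<le> 1024 * (real S * real T / real N + (real T)\<^sup>2 / real N)"
    by (rule success_prob_bound)
qed simp

end
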